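(* Let $\mathcal X,\mathcal Y,F,\Theta,p,r,s,x_0,\xi_0,\rho,B_0,\eta,x^\dagger$ be as in the context (in particular $\mathcal X$ is reflexive and $\mathcal Y$ is uniformly smooth): $F$ satisfies conditions (a)–(d) with $0\le\eta<1$, and $\Theta:\mathcal X\to(-\infty,\infty]$ is proper, lower semi-continuous and $p$-convex with $p\ge2$, satisfying for some $c_0>0$ $$D_\xi\Theta(\bar x,x)\ge c_0\|\bar x-x\|^p\qquad\text{for all }\bar x\in\mathcal X,\ x\in D(\partial\Theta),\ \xi\in\partial\Theta(x).$$ Assume that $D_{\xi_0}\Theta(x^\dagger,x_0)\le c_0\rho^p$, and let $\tau>1$ and $\mu_0>0$ satisfy $$1-3\eta-\frac{3(\eta+1)}{\tau}-3\left(\frac{3\mu_0}{2c_0}\right)^{\frac1{p-1}}>0 .$$ For each $\delta>0$ let $y^\delta\in\mathcal Y$ satisfy $\|y-y^\delta\|\le\delta$, let $\{(x_n^\delta,\xi_n^\delta)\}_{n\ge 0}$ be the sequence generated by the iteration with noisy data $y^\delta$, and let $\{(x_n,\xi_n)\}_{n\ge 0}$ be the sequence generated by the iteration with exact data $y$, both described in the context. Then for all $n\ge0$, $$\xi_n^\delta\to\xi_n\quad\text{and}\quad x_n^\delta\to x_n\qquad\text{as }\delta\to0 .$$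
   Context: **Spaces.** $\mathcal X$ is a uniformly smooth and uniformly convex Banach space (hence reflexive) which is $s$-convex for some $s\in[2,\infty)$ (its modulus of convexity is bounded below by $C\varepsilon^s$ for some $C>0$), and $1/s+1/s^*=1$. $\mathcal Y$ is a uniformly smooth Banach space. $\langle\cdot,\cdot\rangle$ is the duality pairing, $A^*$ the adjoint of a bounded linear operator $A$. Fix $1<r<\infty$. **Duality mappings.** $J_r^{\mathcal Y}:\mathcal Y\to\mathcal Y^*$ is the (single-valued, continuous) duality mapping with gauge $t\mapsto t^{r-1}$: $J_r^{\mathcal Y}(v)$ is the unique $\zeta\in\mathcal Y^*$ with $\|\zeta\|=\|v\|^{r-1}$ and $\langle\zeta,v\rangle=\|v\|^r$. Likewise $J_{s^*}^*:\mathcal X^*\to\mathcal X$ is the duality mapping of $\mathcal X^*$ with gauge $t\mapsto t^{s^*-1}$. **Convex analysis.** For convex $\Theta:\mathcal X\to(-\infty,\infty]$: $D(\Theta)=\{x:\Theta(x)<\infty\}$; $\partial\Theta(x)$ is the subdifferential; $D(\partial\Theta)=\{x\in D(\Theta):\partial\Theta(x)\neq\emptyset\}$; for $\xi\in\partial\Theta(x)$ the Bregman distance is $D_\xi\Theta(z,x)=\Theta(z)-\Theta(x)-\langle\xi,z-x\rangle$. $\Theta$ is $p$-convex if there is $c>0$ with $\Theta(\gamma\bar x+(1-\gamma)x)+\gamma(1-\gamma)c\|\bar x-x\|^p\le\gamma\Theta(\bar x)+(1-\gamma)\Theta(x)$ for all $x,\bar x\in\mathcal X$, $\gamma\in[0,1]$.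 $\Theta^*$ is the Legendre–Fenchel conjugate of $\Theta$ and $\nabla\Theta^*$ its gradient. **Operator and assumptions.** $F:D(F)\subset\mathcal X\to\mathcal Y$ is a (nonlinear) operator and $y\in\mathcal Y$. Initial guess: $x_0\in D(\partial\Theta)$, $\xi_0\in\partial\Theta(x_0)$. $B_\rho(x_0)=\{x\in\mathcal X:\|x-x_0\|\le\rho\}$. Conditions: (a) there is $\rho>0$ with $B_{2\rho}(x_0)\subset D(F)$, and $F(x)=y$ has a solution in $B_\rho(x_0)\cap D(\Theta)$; (b) $F$ is weakly closed on $D(F)$, is Fréchet differentiable on $B_{2\rho}(x_0)$, and $x\mapsto F'(x)$ is continuous on $B_{2\rho}(x_0)$; (c) $\|F'(x)\|\le B_0$ for all $x\in B_{2\rho}(x_0)$ (with a constant $B_0>0$); (d) there is $0\le\eta<1$ with $\|F(x)-F(\bar x)-F'(\bar x)(x-\bar x)\|\le\eta\|F(x)-F(\bar x)\|$ for all $x,\bar x\in B_{2\rho}(x_0)$. $x^\dagger$ denotes a solution of $F(x)=y$ in $D(\Theta)\cap D(F)$ with $D_{\xi_0}\Theta(x^\dagger,x_0)=\min\{D_{\xi_0}\Theta(x,x_0):x\in D(\Theta)\cap D(F),\ F(x)=y\}$. **Iteration with noisy data.** $x_0^\delta=x_0$, $\xi_0^\delta=\xi_0$. With $T_n^\delta:=F'(x_n^\delta)$ and $r_n^\delta:=J_r^{\mathcal Y}(F(x_n^\delta)-y^\delta)$, $$\xi_{n+1}^\delta=\xi_n^\delta-\mu_n^\delta (T_n^\delta)^*\Big(2r_n^\delta-\nu_n^\delta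 J_r^{\mathcal Y}\big(T_n^\delta J_{s^*}^*((T_n^\delta)^*r_n^\delta)\big)\Big),\qquad x_{n+1}^\delta=\nabla\Theta^*(\xi_{n+1}^\delta),$$ (equivalently $x_{n+1}^\delta=\arg\min_{x\in\mathcal X}\{\Theta(x)-\langle\xi_{n+1}^\delta,x\rangle\}$), where, if $\|F(x_n^\delta)-y^\delta\|>\tau\delta$, $$\nu_n^\delta=\frac{\|r_n^\delta\|}{\|J_r^{\mathcal Y}(T_n^\delta J_{s^*}^*((T_n^\delta)^*r_n^\delta))\|},\qquad \mu_n^\delta=\mu_0B_0^{-p}\|F(x_n^\delta)-y^\delta\|^{p-r},$$ (with $\nu_n^\delta:=0$ should the denominator vanish), and $\mu_n^\delta=0$ (iteration terminated, iterates staying constant) if $\|F(x_n^\delta)-y^\delta\|\le\tau\delta$. **Iteration with exact data.** $\{(x_n,\xi_n)\}$ is defined by the same formulas starting from $(x_0,\xi_0)$ with $y^\delta$ replaced by $y$ and $\delta$ replaced by $0$; so $\mu_n=\mu_0B_0^{-p}\|F(x_n)-y\|^{p-r}$ if $F(x_n)\neq y$ and $\mu_n=0$ if $F(x_n)=y$. *)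

theory Defs
  imports "HOL-Analysis.Analysis"
begin

section \<open>Geometry of Banach spaces\<close>

text \<open>The topological dual of \<open>'v\<close> is the type \<open>'v \<Rightarrow>\<^sub>L real\<close> with the operator norm, and the pairing is
  application. The two moduli take values in the extended nonnegative reals only so that the
  supremum and the infimum of the empty set (zero space, or radius above 2) are \<open>0\<close> and \<open>\<infinity>\<close>;
  all quantities under them are nonnegative reals.\<close>

definition modulus_of_convexity :: "'v::real_normed_vector itself \<Rightarrow> real \<Rightarrow> ennreal" where
  "modulus_of_convexity _ \<epsilon> =
     (INF (u, v) \<in> {(u, v :: 'v). norm u = 1 \<and> norm v = 1 \<and> norm (u - v) \<ge> \<epsilon>}.
        ennreal (1 - norm (u + v) / 2))"

definition modulus_of_smoothness :: "'v::real_normed_vector itself \<Rightarrow> real \<Rightarrow> ennreal" where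
  "modulus_of_smoothness _ t =
     (SUP (u, v) \<in> {(u, v :: 'v). norm u = 1 \<and> norm v = 1}.
        ennreal ((norm (u + t *\<^sub>R v) + norm (u - t *\<^sub>R v)) / 2 - 1))"

definition uniformly_convex :: "'v::real_normed_vector itself \<Rightarrow> bool" where
  "uniformly_convex V \<longleftrightarrow> (\<forall>\<epsilon>. 0 < \<epsilon> \<and> \<epsilon> \<le> 2 \<longrightarrow> modulus_of_convexity V \<epsilon> > 0)"

definition power_convex_space :: "'v::real_normed_vector itself \<Rightarrow> real \<Rightarrow> bool" where
  "power_convex_space V s \<longleftrightarrow>
     (\<exists>C>0. \<forall>\<epsilon>. 0 \<le> \<epsilon> \<and> \<epsilon> \<le> 2 \<longrightarrow> modulus_of_convexity V \<epsilon> \<ge> ennreal (C * \<epsilon> powr s))"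

definition uniformly_smooth :: "'v::real_normed_vector itself \<Rightarrow> bool" where
  "uniformly_smooth V \<longleftrightarrow>
     ((\<lambda>t. modulus_of_smoothness V t / ennreal t) \<longlongrightarrow> 0) (at_right 0)"

definition weakly_tendsto :: "(nat \<Rightarrow> 'v::real_normed_vector) \<Rightarrow> 'v \<Rightarrow> bool" where
  "weakly_tendsto u v \<longleftrightarrow>
     (\<forall>\<phi> :: 'v \<Rightarrow>\<^sub>L real. (\<lambda>n. blinfun_apply \<phi> (u n)) \<longlonglongrightarrow> blinfun_apply \<phi> v)"

definition weakly_closed_on ::
  "('a::real_normed_vector \<Rightarrow> 'b::real_normed_vector) \<Rightarrow> 'a set \<Rightarrow> bool" where
  "weakly_closed_on F D \<longleftrightarrow>
     (\<forall>u x v. (\<forall>n. u n \<in> D) \<and> weakly_tendsto u x \<and> weakly_tendsto (\<lambda>n. F (u n)) v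
        \<longrightarrow> x \<in> D \<and> F x = v)"

definition dual_op ::
  "('a::real_normed_vector \<Rightarrow>\<^sub>L 'b::real_normed_vector) \<Rightarrow> ('b \<Rightarrow>\<^sub>L real) \<Rightarrow> ('a \<Rightarrow>\<^sub>L real)" where
  "dual_op A \<zeta> = \<zeta> o\<^sub>L A"

text \<open>Duality mapping with gauge \<open>t \<mapsto> t powr (q - 1)\<close>. Existence and uniqueness of the described
  element hold when the space is smooth.\<close>

definition duality_map :: "real \<Rightarrow> 'v::real_normed_vector \<Rightarrow> ('v \<Rightarrow>\<^sub>L real)" where
  "duality_map q v =
     (THE \<zeta>. norm \<zeta> = norm v powr (q - 1) \<and> blinfun_apply \<zeta> v = norm v powr q)"

text \<open>Duality mapping of the dual space, with the bidual of the reflexive space \<open>'v\<close> identified with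
  \<open>'v\<close>; well defined when \<open>'v\<close> is moreover strictly convex.\<close>

definition dual_duality_map :: "real \<Rightarrow> ('v::real_normed_vector \<Rightarrow>\<^sub>L real) \<Rightarrow> 'v" where
  "dual_duality_map q \<xi> =
     (THE v. norm v = norm \<xi> powr (q - 1) \<and> blinfun_apply \<xi> v = norm \<xi> powr q)"


section \<open>Convex analysis\<close>

definition effective_domain :: "('a \<Rightarrow> ereal) \<Rightarrow> 'a set" where
  "effective_domain \<Theta> = {x. \<Theta> x < \<infinity>}"

definition proper_fun :: "('a \<Rightarrow> ereal) \<Rightarrow> bool" where
  "proper_fun \<Theta> \<longleftrightarrow> (\<forall>x. \<Theta> x \<noteq> -\<infinity>) \<and> effective_domain \<Theta> \<noteq> {}"

definition lsc_fun :: "('a::topological_space \<Rightarrow> ereal) \<Rightarrow> bool" where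
  "lsc_fun \<Theta> \<longleftrightarrow> (\<forall>x. \<Theta> x \<le> Liminf (at x) \<Theta>)"

definition p_convex_fun :: "real \<Rightarrow> ('a::real_normed_vector \<Rightarrow> ereal) \<Rightarrow> bool" where
  "p_convex_fun p \<Theta> \<longleftrightarrow>
     (\<exists>c>0. \<forall>x z. \<forall>\<gamma>\<in>{0..1}.
        \<Theta> (\<gamma> *\<^sub>R z + (1 - \<gamma>) *\<^sub>R x) + ereal (\<gamma> * (1 - \<gamma>) * c * norm (z - x) powr p)
          \<le> ereal \<gamma> * \<Theta> z + ereal (1 - \<gamma>) * \<Theta> x)"

definition subdifferential ::
  "('a::real_normed_vector \<Rightarrow> ereal) \<Rightarrow> 'a \<Rightarrow> ('a \<Rightarrow>\<^sub>L real) set" where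
  "subdifferential \<Theta> x =
     {\<xi>. \<forall>z. \<Theta> z \<ge> \<Theta> x + ereal (blinfun_apply \<xi> (z - x))}"

definition subdiff_domain :: "('a::real_normed_vector \<Rightarrow> ereal) \<Rightarrow> 'a set" where
  "subdiff_domain \<Theta> = {x \<in> effective_domain \<Theta>. subdifferential \<Theta> x \<noteq> {}}"

definition bregman ::
  "('a::real_normed_vector \<Rightarrow> ereal) \<Rightarrow> ('a \<Rightarrow>\<^sub>L real) \<Rightarrow> 'a \<Rightarrow> 'a \<Rightarrow> ereal" where
  "bregman \<Theta> \<xi> z x = \<Theta> z - \<Theta> x - ereal (blinfun_apply \<xi> (z - x))"

definition conjugate :: "('a::real_normed_vector \<Rightarrow> ereal) \<Rightarrow> ('a \<Rightarrow>\<^sub>L real) \<Rightarrow> ereal" where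
  "conjugate \<Theta> \<xi> = (SUP x. ereal (blinfun_apply \<xi> x) - \<Theta> x)"

text \<open>Frechet gradient of the conjugate. It lies in the bidual, identified with \<open>'a\<close> by
  reflexivity: \<open>x\<close> stands for the functional \<open>h \<mapsto> h x\<close>. Finiteness near \<open>\<xi>\<close> is required since
  \<open>real_of_ereal\<close> maps infinite values to 0.\<close>

definition has_conjugate_gradient ::
  "('a::real_normed_vector \<Rightarrow> ereal) \<Rightarrow> ('a \<Rightarrow>\<^sub>L real) \<Rightarrow> 'a \<Rightarrow> bool" where
  "has_conjugate_gradient \<Theta> \<xi> x \<longleftrightarrow>
     (\<forall>\<^sub>F \<omega> in nhds \<xi>. \<bar>conjugate \<Theta> \<omega>\<bar> \<noteq> \<infinity>) \<and>
     ((\<lambda>\<omega>. real_of_ereal (conjugate \<Theta> \<omega>)) has_derivative (\<lambda>h. blinfun_apply h x)) (at \<xi>)"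

definition grad_conjugate ::
  "('a::real_normed_vector \<Rightarrow> ereal) \<Rightarrow> ('a \<Rightarrow>\<^sub>L real) \<Rightarrow> 'a" where
  "grad_conjugate \<Theta> \<xi> = (THE x. has_conjugate_gradient \<Theta> \<xi> x)"


section \<open>The iteration\<close>

text \<open>One step from \<open>(x, \<xi>)\<close> with data \<open>v\<close> and noise level \<open>\<delta>\<close>; exact data is the case \<open>\<delta> = 0\<close>.
  The exponent \<open>q\<close> is that of the duality mapping of the dual of \<open>'a\<close>.
  The convention that \<open>\<nu>\<close> is 0 for vanishing denominator is Isabelle's \<open>a / 0 = 0\<close>.\<close>

definition iteration_step ::
  "('a::real_normed_vector \<Rightarrow> 'b::real_normed_vector) \<Rightarrow> ('a \<Rightarrow> 'a \<Rightarrow>\<^sub>L 'b) \<Rightarrow> ('a \<Rightarrow> ereal)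
   \<Rightarrow> real \<Rightarrow> real \<Rightarrow> real \<Rightarrow> real \<Rightarrow> real \<Rightarrow> real \<Rightarrow> real \<Rightarrow> 'b
   \<Rightarrow> 'a \<times> ('a \<Rightarrow>\<^sub>L real) \<Rightarrow> 'a \<times> ('a \<Rightarrow>\<^sub>L real)" where
  "iteration_step F F' \<Theta> p r q \<mu>\<^sub>0 B\<^sub>0 \<tau> \<delta> v = (\<lambda>(x, \<xi>).
     let T = F' x;
         d = norm (F x - v);
         res = duality_map r (F x - v);
         w = duality_map r (blinfun_apply T (dual_duality_map q (dual_op T res)));
         \<nu> = norm res / norm w;
         \<mu> = (if d > \<tau> * \<delta> then \<mu>\<^sub>0 * B\<^sub>0 powr (- p) * d powr (p - r) else 0);
         \<xi>' = \<xi> - \<mu> *\<^sub>R dual_op T (2 *\<^sub>R res - \<nu> *\<^sub>R w)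
     in (grad_conjugate \<Theta> \<xi>', \<xi>'))"

definition iterates ::
  "('a::real_normed_vector \<Rightarrow> 'b::real_normed_vector) \<Rightarrow> ('a \<Rightarrow> 'a \<Rightarrow>\<^sub>L 'b) \<Rightarrow> ('a \<Rightarrow> ereal)
   \<Rightarrow> real \<Rightarrow> real \<Rightarrow> real \<Rightarrow> real \<Rightarrow> real \<Rightarrow> real \<Rightarrow> 'a \<Rightarrow> ('a \<Rightarrow>\<^sub>L real)
   \<Rightarrow> real \<Rightarrow> 'b \<Rightarrow> nat \<Rightarrow> 'a \<times> ('a \<Rightarrow>\<^sub>L real)" where
  "iterates F F' \<Theta> p r q \<mu>\<^sub>0 B\<^sub>0 \<tau> x\<^sub>0 \<xi>\<^sub>0 \<delta> v n =
     (iteration_step F F' \<Theta> p r q \<mu>\<^sub>0 B\<^sub>0 \<tau> \<delta> v ^^ n) (x\<^sub>0, \<xi>\<^sub>0)"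

end

theory Submission
  imports Defs
begin

text \<open>The proof is an induction on the number of steps: if \<open>\<xi>\<^sub>n\<close> and \<open>x\<^sub>n\<close> depend continuously on the noise level
  at 0, then so do \<open>\<xi>\<^sub>n\<^sub>+\<^sub>1\<close> and \<open>x\<^sub>n\<^sub>+\<^sub>1\<close>. Four facts carry the step.

  \<^item> The duality mapping of a uniformly smooth space and that of the dual of a uniformly convex Banach space
    are well defined, and norm continuous away from 0 (\<open>continuous_on_duality_map\<close>,
    \<open>continuous_on_dual_duality_map\<close>).

  \<^item> Since \<open>\<Theta>\<close> is p-convex, every functional is a subgradient at exactly one point, this point is the
    gradient of the conjugate, and it depends Hoelder continuously on the functional
    (\<open>grad_conjugate_eq\<close>, \<open>subgradient_inverse_holder\<close>). Hence convergence of \<open>\<xi>\<^sub>n\<close> entails that of \<open>x\<^sub>n\<close>.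

  \<^item> Under the condition on \<open>\<eta>\<close>, \<open>\<tau>\<close>, \<open>\<mu>\<^sub>0\<close> the Bregman distance to the solution \<open>xdag\<close> does not increase along
    the noisy or the exact iteration. This confines all iterates to the ball of radius \<open>2 \<rho>\<close> about \<open>x\<^sub>0\<close>,
    where \<open>F\<close> and \<open>F'\<close> are continuous (\<open>bregman_step_le\<close>, \<open>fst_iter_in_cball\<close>).

  \<^item> The update of \<open>\<xi>\<^sub>n\<close> is continuous at exact data (\<open>tendsto_update\<close>), although the step size jumps at the
    discrepancy threshold and the quotient \<open>\<nu>\<close> is singular. If \<open>F x\<^sub>n \<noteq> y\<close>, the tangential cone condition
    keeps every argument of a duality mapping away from 0, and the threshold is eventually exceeded. If
    \<open>F x\<^sub>n = y\<close>, the exact iteration rests, and the noisy update is at most a constant times the power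
    \<open>p - 1\<close> of a residual that tends to 0.\<close>

section \<open>Duality mappings of uniformly smooth spaces\<close>

lemma uniformly_smoothE:
  assumes "uniformly_smooth TYPE('v::real_normed_vector)" "\<epsilon> > 0"
  obtains t where "t > 0"
    "\<And>u h :: 'v. norm u = 1 \<Longrightarrow> norm h = 1 \<Longrightarrow>
       norm (u + t *\<^sub>R h) + norm (u - t *\<^sub>R h) \<le> 2 + \<epsilon> * t"
proof -
  let ?m = "modulus_of_smoothness TYPE('v)"
  have "\<forall>\<^sub>F t in at_right 0. ?m t / ennreal t < ennreal (\<epsilon> / 2)"
    using assms unfolding uniformly_smooth_def by (intro order_tendstoD(2)) auto
  moreover have "\<forall>\<^sub>F t in at_right (0::real). t > 0"
    by (simp add: eventually_at_right_less)
  ultimately have "\<forall>\<^sub>F t in at_right 0. ?m t / ennreal t < ennreal (\<epsilon> / 2) \<and> t > 0"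
    by (rule eventually_conj)
  then obtain t where t: "?m t / ennreal t < ennreal (\<epsilon> / 2)" "t > 0"
    using eventually_happens'[OF trivial_limit_at_right_real] by blast
  obtain m where m: "?m t = ennreal m" "m \<ge> 0"
  proof (cases "?m t")
    case (real m) then show ?thesis using that by auto
  next
    case top then show ?thesis using t by (simp add: ennreal_top_divide)
  qed
  have mle: "2 * m \<le> \<epsilon> * t"
  proof -
    have "m / t < \<epsilon> / 2"
      using t m by (simp add: divide_ennreal ennreal_less_iff)
    then show ?thesis using t by (simp add: field_simps)
  qed
  have "norm (u + t *\<^sub>R h) + norm (u - t *\<^sub>R h) \<le> 2 + \<epsilon> * t" if "norm u = 1" "norm h = 1" for u h :: 'v
  proof -
    have "ennreal ((norm (u + t *\<^sub>R h) + norm (u - t *\<^sub>R h)) / 2 - 1) \<le> ?m t"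
      unfolding modulus_of_smoothness_def by (rule SUP_upper2[where i="(u,h)"]) (use that in auto)
    then have "(norm (u + t *\<^sub>R h) + norm (u - t *\<^sub>R h)) / 2 - 1 \<le> m"
      using m by (simp add: ennreal_le_iff)
    then show ?thesis using mle by argo
  qed
  then show ?thesis using that t by blast
qed

text \<open>The functional is the derivative of the norm at \<open>u\<close>: by convexity the difference quotients decrease
  to a sublinear one-sided derivative as the increment tends to 0, and smoothness makes that derivative
  odd, hence linear.\<close>

lemma support_functional_exists:
  fixes u :: "'v::real_normed_vector"
  assumes smooth: "uniformly_smooth TYPE('v)" and u: "norm u = 1"
  shows "\<exists>\<phi> :: 'v \<Rightarrow>\<^sub>L real. norm \<phi> = 1 \<and> blinfun_apply \<phi> u = 1"
proof -
  define q where "q t h = (norm (u + t *\<^sub>R h) - 1) / t" for t h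
  define g where "g h = (INF t\<in>{0<..}. q t h)" for h
  have q_lower: "- norm h \<le> q t h" if "t > 0" for t h
  proof -
    have "1 \<le> norm (u + t *\<^sub>R h) + norm (t *\<^sub>R h)"
      using norm_triangle_ineq4[of "u + t *\<^sub>R h" "t *\<^sub>R h"] u by simp
    then show ?thesis using that by (simp add: q_def field_simps)
  qed
  have q_upper: "q t h \<le> norm h" if "t > 0" for t h
  proof -
    have "norm (u + t *\<^sub>R h) \<le> 1 + t * norm h"
      using norm_triangle_ineq[of "u" "t *\<^sub>R h"] u that by simp
    then show ?thesis using that by (simp add: q_def field_simps)
  qed
  \<comment> \<open>Convexity of the norm, with \<open>u + s h\<close> written as a convex combination of \<open>u\<close> and \<open>u + t h\<close>.\<close>
  have q_mono: "q s h \<le> q t h" if "0 < s" "s \<le> t" for s t h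
  proof -
    have "u + s *\<^sub>R h = (1 - s/t) *\<^sub>R u + (s/t) *\<^sub>R (u + t *\<^sub>R h)"
      using that by (simp add: algebra_simps)
    then have "norm (u + s *\<^sub>R h) \<le> norm ((1 - s/t) *\<^sub>R u) + norm ((s/t) *\<^sub>R (u + t *\<^sub>R h))"
      by (metis norm_triangle_ineq)
    also have "\<dots> = (1 - s/t) + (s/t) * norm (u + t *\<^sub>R h)"
      using that u by simp
    finally have "norm (u + s *\<^sub>R h) - 1 \<le> s * q t h"
      by (simp add: q_def diff_divide_distrib right_diff_distrib)
    then show ?thesis using that by (simp add: q_def[of s] pos_divide_le_eq mult.commute)
  qed
  have bdd: "bdd_below ((\<lambda>t. q t h) ` {0<..})" for h
    by (intro bdd_belowI[of _ "- norm h"]) (use q_lower in auto)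
  have g_le: "g h \<le> q t h" if "t > 0" for t h
    unfolding g_def by (rule cINF_lower[OF bdd]) (use that in auto)
  have g_ge: "a \<le> g h" if "\<And>t. t > 0 \<Longrightarrow> a \<le> q t h" for a h
    unfolding g_def by (rule cINF_greatest) (use that in \<open>auto intro: exI[of _ 1]\<close>)
  have g_subadd: "g (a + b) \<le> g a + g b" for a b
  proof -
    have *: "g (a + b) \<le> q s a + q t b" if "s > 0" "t > 0" for s t
    proof -
      define k where "k = min s t / 2"
      have k: "k > 0" "2 * k \<le> s" "2 * k \<le> t" using that by (auto simp: k_def)
      have "2 *\<^sub>R (u + k *\<^sub>R (a + b)) = (u + (2*k) *\<^sub>R a) + (u + (2*k) *\<^sub>R b)"
        by (simp add: algebra_simps scaleR_2)
      then have "2 * norm (u + k *\<^sub>R (a + b)) \<le> norm (u + (2*k) *\<^sub>R a) + norm (u + (2*k) *\<^sub>R b)"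
        by (metis norm_triangle_ineq norm_scaleR abs_numeral)
      then have "(2 * norm (u + k *\<^sub>R (a + b)) - 2) / (2 * k)
          \<le> (norm (u + (2*k) *\<^sub>R a) + norm (u + (2*k) *\<^sub>R b) - 2) / (2 * k)"
        using k by (intro divide_right_mono) auto
      then have "q k (a + b) \<le> q (2*k) a + q (2*k) b"
        using k by (simp add: q_def diff_divide_distrib add_divide_distrib)
      also have "\<dots> \<le> q s a + q t b" using q_mono k by (intro add_mono) auto
      finally show ?thesis using g_le[of k "a + b"] k by linarith
    qed
    have "g (a + b) - q s a \<le> g b" if "s > 0" for s
      by (rule g_ge) (use *[OF that] in \<open>simp add: algebra_simps\<close>)
    then have "g (a + b) - g b \<le> g a"
      by (intro g_ge) (simp add: algebra_simps)
    then show ?thesis by simp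
  qed
  have g_le_norm: "g h \<le> norm h" for h
    using g_le[of 1 h] q_upper[of 1 h] by simp
  have g_hom_le: "g (c *\<^sub>R h) \<le> c * g h" if "c > 0" for c h
  proof -
    have "g (c *\<^sub>R h) / c \<le> g h"
    proof (rule g_ge)
      fix t :: real assume "t > 0"
      have "q (t/c) (c *\<^sub>R h) = c * q t h" using that \<open>t > 0\<close> by (simp add: q_def)
      with g_le[of "t/c" "c *\<^sub>R h"] that \<open>t > 0\<close>
      show "g (c *\<^sub>R h) / c \<le> q t h" by (simp add: field_simps)
    qed
    then show ?thesis using that by (simp add: field_simps)
  qed
  have g_zero: "g 0 = 0"
    using g_le_norm[of 0] g_subadd[of 0 0] by simp
  have g_hom: "g (c *\<^sub>R h) = c * g h" if "c \<ge> 0" for c h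
  proof (cases "c = 0")
    case False
    then have c: "c > 0" using that by simp
    have "g (inverse c *\<^sub>R (c *\<^sub>R h)) \<le> inverse c * g (c *\<^sub>R h)"
      by (rule g_hom_le) (use c in simp)
    then have "c * g h \<le> g (c *\<^sub>R h)" using c by (simp add: field_simps)
    then show ?thesis using g_hom_le[OF c, of h] by linarith
  qed (simp add: g_zero)
  \<comment> \<open>Smoothness: the quotients in opposite directions add up to at most any given \<open>e\<close>.\<close>
  have g_odd_unit: "g (- h) \<le> - g h" if h: "norm h = 1" for h
  proof (rule field_le_epsilon)
    fix e :: real assume "e > 0"
    then obtain t where t: "t > 0" "norm (u + t *\<^sub>R h) + norm (u - t *\<^sub>R h) \<le> 2 + e * t"
      using uniformly_smoothE[OF smooth] u h by metis
    have "q t h + q t (- h) = (norm (u + t *\<^sub>R h) + norm (u - t *\<^sub>R h) - 2) / t"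
      by (simp add: q_def diff_divide_distrib add_divide_distrib)
    also have "\<dots> \<le> e" using t by (simp add: pos_divide_le_eq)
    finally have "q t h + q t (- h) \<le> e" .
    then show "g (- h) \<le> - g h + e" using g_le[OF t(1), of h] g_le[OF t(1), of "- h"] by linarith
  qed
  have g_neg: "g (- h) = - g h" for h
  proof (cases "h = 0")
    case False
    have "g (norm h *\<^sub>R (- sgn h)) = norm h * g (- sgn h)" by (rule g_hom) simp
    also have "\<dots> \<le> norm h * (- g (sgn h))"
      by (intro mult_left_mono g_odd_unit) (use False in \<open>auto simp: norm_sgn\<close>)
    also have "\<dots> = - g (norm h *\<^sub>R sgn h)" by (simp add: g_hom)
    finally have "g (- h) \<le> - g h" using False by (simp add: sgn_div_norm)
    then show ?thesis using g_subadd[of h "- h"] g_zero by simp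
  qed (simp add: g_zero)
  have g_add: "g (a + b) = g a + g b" for a b
    using g_subadd[of a b] g_subadd[of "- a" "- b"] g_neg[of "a + b"] g_neg[of a] g_neg[of b]
    by (simp add: add.commute)
  have g_scale: "g (c *\<^sub>R h) = c * g h" for c h
    using g_hom[of c h] g_hom[of "- c" h] g_neg[of "c *\<^sub>R h"] by (cases "c \<ge> 0") auto
  have g_bound: "\<bar>g h\<bar> \<le> norm h" for h
    using g_le_norm[of h] g_le_norm[of "- h"] g_neg[of h] by auto
  have bl: "bounded_linear g"
    by (rule bounded_linear_intro[of _ 1]) (use g_add g_scale g_bound in auto)
  have "q t u = 1" if "t > 0" for t
  proof -
    have "u + t *\<^sub>R u = (1 + t) *\<^sub>R u" by (simp add: algebra_simps)
    then have "norm (u + t *\<^sub>R u) = 1 + t" using u that by (simp only: norm_scaleR) simp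
    then show ?thesis using that by (simp add: q_def)
  qed
  then have "g u = 1" using g_ge[of 1 u] g_le_norm[of u] u by simp
  moreover have "norm (Blinfun g) = 1"
  proof (rule antisym)
    show "norm (Blinfun g) \<le> 1"
      by (rule norm_blinfun_bound) (use g_bound bl in \<open>auto simp: bounded_linear_Blinfun_apply\<close>)
    show "1 \<le> norm (Blinfun g)"
      using norm_blinfun[of "Blinfun g" u] \<open>g u = 1\<close> bl u by (simp add: bounded_linear_Blinfun_apply)
  qed
  ultimately show ?thesis
    using bl by (intro exI[of _ "Blinfun g"]) (simp add: bounded_linear_Blinfun_apply)
qed

text \<open>Evaluating \<open>\<phi>\<close> at \<open>u + t h\<close> and \<open>\<psi>\<close> at \<open>u - t h\<close> bounds \<open>t (\<phi> - \<psi>) h\<close> by the modulus of smoothness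
  plus the distance of the two base points. This one estimate gives uniqueness of support
  functionals and their uniform continuity.\<close>

lemma support_functionals_close:
  assumes smooth: "uniformly_smooth TYPE('v::real_normed_vector)" and "\<epsilon> > 0"
  obtains d where "d > 0"
    "\<And>(u::'v) v (\<phi>::'v \<Rightarrow>\<^sub>L real) \<psi>. \<lbrakk>norm u = 1; norm v = 1; norm \<phi> = 1; norm \<psi> = 1; blinfun_apply \<phi> u = 1; blinfun_apply \<psi> v = 1;
       norm (u - v) \<le> d\<rbrakk> \<Longrightarrow> norm (\<phi> - \<psi>) \<le> \<epsilon>"
proof -
  obtain t where t: "t > 0" "\<And>u h :: 'v. norm u = 1 \<Longrightarrow> norm h = 1 \<Longrightarrow>
       norm (u + t *\<^sub>R h) + norm (u - t *\<^sub>R h) \<le> 2 + (\<epsilon> / 2) * t"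
    using uniformly_smoothE[OF smooth, of "\<epsilon> / 2"] \<open>\<epsilon> > 0\<close> by auto
  define d where "d = \<epsilon> / 2 * t"
  have "d > 0" using t \<open>\<epsilon> > 0\<close> by (simp add: d_def)
  moreover have "norm (\<phi> - \<psi>) \<le> \<epsilon>"
    if *: "norm u = 1" "norm v = 1" "norm \<phi> = 1" "norm \<psi> = 1" "blinfun_apply \<phi> u = 1" "blinfun_apply \<psi> v = 1" "norm (u - v) \<le> d"
    for u v :: 'v and \<phi> \<psi> :: "'v \<Rightarrow>\<^sub>L real"
  proof -
    have unit: "(\<phi> - \<psi>) h \<le> \<epsilon>" if h: "norm h = 1" for h
    proof -
      have "\<phi> (u + t *\<^sub>R h) \<le> norm (u + t *\<^sub>R h)"
        using norm_blinfun[of \<phi> "u + t *\<^sub>R h"] * by simp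
      moreover have "\<psi> (u - t *\<^sub>R h) \<le> norm (u - t *\<^sub>R h)"
        using norm_blinfun[of \<psi> "u - t *\<^sub>R h"] * by simp
      moreover have "\<psi> (v - u) \<le> d"
        using norm_blinfun[of \<psi> "v - u"] * by (simp add: norm_minus_commute)
      ultimately have "t * (\<phi> - \<psi>) h \<le> (\<epsilon> / 2) * t + d"
        using t(2)[of u h] h *
        by (simp add: blinfun.add_right blinfun.diff_right blinfun.scaleR_right blinfun.diff_left
            right_diff_distrib)
      also have "\<dots> = t * \<epsilon>" by (simp add: d_def)
      finally show ?thesis using t(1) by simp
    qed
    have "norm ((\<phi> - \<psi>) h) \<le> \<epsilon> * norm h" for h
    proof (cases "h = 0")
      case False
      have "\<bar>(\<phi> - \<psi>) (sgn h)\<bar> \<le> \<epsilon>"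
        using unit[of "sgn h"] unit[of "- sgn h"] False
        by (auto simp: norm_sgn blinfun.minus_right)
      then show ?thesis
        using False by (simp add: sgn_div_norm blinfun.scaleR_right abs_mult field_simps)
    qed (simp add: blinfun.zero_right)
    then show ?thesis using \<open>\<epsilon> > 0\<close> by (intro norm_blinfun_bound) auto
  qed
  ultimately show ?thesis using that by blast
qed

definition support_functional :: "'v::real_normed_vector \<Rightarrow> 'v \<Rightarrow>\<^sub>L real" where
  "support_functional u = (THE \<phi>. norm \<phi> = 1 \<and> blinfun_apply \<phi> u = 1)"

lemma support_functional_unique:
  fixes u :: "'v::real_normed_vector"
  assumes smooth: "uniformly_smooth TYPE('v)" and u: "norm u = 1"
    and "norm \<phi> = 1" "blinfun_apply \<phi> u = 1" "norm \<psi> = 1" "blinfun_apply \<psi> u = 1"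
  shows "\<phi> = (\<psi> :: 'v \<Rightarrow>\<^sub>L real)"
proof -
  have "norm (\<phi> - \<psi>) \<le> 0 + e" if "e > 0" for e
    using support_functionals_close[OF smooth that] assms
    by (metis add_0 diff_self less_eq_real_def norm_zero)
  then have "norm (\<phi> - \<psi>) \<le> 0" by (rule field_le_epsilon)
  then show ?thesis by simp
qed

lemma support_functional:
  fixes u :: "'v::real_normed_vector"
  assumes smooth: "uniformly_smooth TYPE('v)" and u: "norm u = 1"
  shows "norm (support_functional u) = 1" "support_functional u u = 1"
proof -
  have "\<exists>!\<phi> :: 'v \<Rightarrow>\<^sub>L real. norm \<phi> = 1 \<and> blinfun_apply \<phi> u = 1"
    using support_functional_exists[OF assms] support_functional_unique[OF assms] by blast
  from theI'[OF this] show "norm (support_functional u) = 1" "support_functional u u = 1"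
    unfolding support_functional_def by auto
qed

lemma continuous_on_support_functional:
  assumes smooth: "uniformly_smooth TYPE('v::real_normed_vector)"
  shows "continuous_on (sphere (0::'v) 1) support_functional"
  unfolding continuous_on_iff
proof (intro ballI allI impI)
  fix u :: 'v and e :: real assume u: "u \<in> sphere 0 1" and "0 < e"
  then have "e / 2 > 0" by simp
  from support_functionals_close[OF smooth this] obtain d where d: "d > 0"
    "\<And>(u::'v) v (\<phi>::'v \<Rightarrow>\<^sub>L real) \<psi>. \<lbrakk>norm u = 1; norm v = 1; norm \<phi> = 1; norm \<psi> = 1; blinfun_apply \<phi> u = 1; blinfun_apply \<psi> v = 1;
       norm (u - v) \<le> d\<rbrakk> \<Longrightarrow> norm (\<phi> - \<psi>) \<le> e / 2" by metis
  show "\<exists>d>0. \<forall>v\<in>sphere 0 1. dist v u < d \<longrightarrow> dist (support_functional v) (support_functional u) < e"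
  proof (intro exI[of _ d] conjI ballI impI d(1))
    fix v :: 'v assume "v \<in> sphere 0 1" "dist v u < d"
    then have "norm (support_functional v - support_functional u) \<le> e / 2"
      using u support_functional[OF smooth] by (intro d(2)[of v u]) (auto simp: dist_norm)
    then show "dist (support_functional v) (support_functional u) < e"
      using \<open>0 < e\<close> by (simp add: dist_norm)
  qed
qed

lemma duality_map_eq:
  fixes v :: "'v::real_normed_vector"
  assumes smooth: "uniformly_smooth TYPE('v)" and v: "v \<noteq> 0"
  shows "duality_map r v = norm v powr (r - 1) *\<^sub>R support_functional (sgn v)"
  unfolding duality_map_def
proof (rule the_equality)
  have sgn1: "norm (sgn v) = 1" using v by (simp add: norm_sgn)
  have gauge: "norm v powr (r - 1) * norm v = norm v powr r"
    using v by (simp add: powr_diff)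
  have v_eq: "v = norm v *\<^sub>R sgn v" using v by (simp add: sgn_div_norm)
  have "support_functional (sgn v) v = norm v"
    using support_functional(2)[OF smooth sgn1] v_eq by (metis blinfun.scaleR_right mult.right_neutral real_scaleR_def)
  then show "norm (norm v powr (r - 1) *\<^sub>R support_functional (sgn v)) = norm v powr (r - 1) \<and>
      (norm v powr (r - 1) *\<^sub>R support_functional (sgn v)) v = norm v powr r"
    using support_functional(1)[OF smooth sgn1] gauge by (simp add: blinfun.scaleR_left)
  fix \<zeta> :: "'v \<Rightarrow>\<^sub>L real"
  assume \<zeta>: "norm \<zeta> = norm v powr (r - 1) \<and> \<zeta> v = norm v powr r"
  let ?n = "norm v powr (r - 1)"
  have n: "?n > 0" using v by simp
  have "(inverse ?n *\<^sub>R \<zeta>) (sgn v) = 1"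
    using \<zeta> n v gauge by (simp add: sgn_div_norm blinfun.scaleR_left blinfun.scaleR_right field_simps)
  moreover have "norm (inverse ?n *\<^sub>R \<zeta>) = 1" using \<zeta> n by simp
  ultimately have "inverse ?n *\<^sub>R \<zeta> = support_functional (sgn v)"
    using support_functional_unique[OF smooth sgn1] support_functional[OF smooth sgn1] by blast
  then show "\<zeta> = ?n *\<^sub>R support_functional (sgn v)" using n by (metis less_irrefl scaleR_scaleR right_inverse scaleR_one)
qed

lemma duality_map_zero: "duality_map r (0::'v::real_normed_vector) = 0"
  unfolding duality_map_def by (rule the_equality) auto

lemma duality_map:
  fixes v :: "'v::real_normed_vector"
  assumes smooth: "uniformly_smooth TYPE('v)"
  shows norm_duality_map: "norm (duality_map r v) = norm v powr (r - 1)"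
    and duality_map_self: "duality_map r v v = norm v powr r"
proof -
  have "norm (duality_map r v) = norm v powr (r - 1) \<and> duality_map r v v = norm v powr r"
  proof (cases "v = 0")
    case False
    have sgn1: "norm (sgn v) = 1" using False by (simp add: norm_sgn)
    have "support_functional (sgn v) (norm v *\<^sub>R sgn v) = norm v"
      using support_functional(2)[OF smooth sgn1] by (simp add: blinfun.scaleR_right)
    then have "support_functional (sgn v) v = norm v" using False by (simp add: sgn_div_norm)
    then show ?thesis
      using support_functional(1)[OF smooth sgn1] False
      by (simp add: duality_map_eq[OF smooth False] blinfun.scaleR_left powr_diff)
  qed (simp add: duality_map_zero)
  then show "norm (duality_map r v) = norm v powr (r - 1)" "duality_map r v v = norm v powr r" by auto
qed

lemma continuous_on_duality_map:
  assumes smooth: "uniformly_smooth TYPE('v::real_normed_vector)"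
  shows "continuous_on (- {0::'v}) (duality_map r)"
proof -
  have "continuous_on (- {0::'v}) (\<lambda>v. norm v powr (r - 1) *\<^sub>R support_functional (sgn v))"
    by (intro continuous_intros continuous_on_compose2[OF continuous_on_support_functional[OF smooth]])
      (auto simp: norm_sgn split: if_splits)
  then show ?thesis
    by (rule continuous_on_eq) (simp add: duality_map_eq[OF smooth])
qed


lemma tendsto_duality_map:
  fixes f :: "'c \<Rightarrow> 'v::real_normed_vector"
  assumes smooth: "uniformly_smooth TYPE('v)" and f: "(f \<longlongrightarrow> l) net" and "l \<noteq> 0"
  shows "((\<lambda>t. duality_map r (f t)) \<longlongrightarrow> duality_map r l) net"
  using tendsto_imp_eventually_ne[OF f] assms(2,3)
  by (intro continuous_on_tendsto_compose[OF continuous_on_duality_map[OF smooth]]) auto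


section \<open>The duality mapping of the dual of a uniformly convex space\<close>

lemma uniformly_convexE:
  assumes "uniformly_convex TYPE('v::real_normed_vector)" "\<epsilon> > 0"
  obtains d where "d > 0"
    "\<And>u v :: 'v. norm u = 1 \<Longrightarrow> norm v = 1 \<Longrightarrow> norm (u + v) > 2 - d \<Longrightarrow> norm (u - v) < \<epsilon>"
proof -
  let ?e = "min \<epsilon> 2"
  have "modulus_of_convexity TYPE('v) ?e > 0"
    using assms unfolding uniformly_convex_def by auto
  then obtain d where d: "ennreal d < modulus_of_convexity TYPE('v) ?e" "d > 0"
    by (metis ennreal_less_zero_iff ennreal_cases dense infinity_ennreal_def leD top_greatest)
  have "norm (u - v) < \<epsilon>" if *: "norm u = 1" "norm v = 1" "norm (u + v) > 2 - 2 * d" for u v :: 'v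
  proof (rule ccontr)
    assume "\<not> norm (u - v) < \<epsilon>"
    then have "modulus_of_convexity TYPE('v) ?e \<le> ennreal (1 - norm (u + v) / 2)"
      unfolding modulus_of_convexity_def by (intro INF_lower2[of "(u,v)"]) (use * in auto)
    with d have "ennreal d < ennreal (1 - norm (u + v) / 2)" by (meson order_less_le_trans)
    then show False using d * by (simp add: ennreal_less_iff)
  qed
  then show ?thesis using that[of "2 * d"] d by auto
qed

lemma near_norming_vector:
  fixes \<phi> :: "'v::real_normed_vector \<Rightarrow>\<^sub>L real"
  assumes "0 \<le> c" "c < norm \<phi>"
  obtains u where "norm u = 1" "\<phi> u > c"
proof (rule ccontr)
  assume "\<not> thesis"
  then have *: "\<phi> u \<le> c" if "norm u = 1" for u using that \<open>\<And>u. _ \<Longrightarrow> _ \<Longrightarrow> thesis\<close> by force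
  have "norm (\<phi> h) \<le> c * norm h" for h
  proof (cases "h = 0")
    case False
    have "\<bar>\<phi> (sgn h)\<bar> \<le> c"
      using *[of "sgn h"] *[of "- sgn h"] False by (auto simp: norm_sgn blinfun.minus_right)
    then show ?thesis
      using False by (simp add: sgn_div_norm blinfun.scaleR_right abs_mult field_simps)
  qed (simp add: blinfun.zero_right)
  then have "norm \<phi> \<le> c" using assms by (intro norm_blinfun_bound) auto
  with assms show False by simp
qed

text \<open>Two unit vectors at which unit functionals come close to the norm have a sum of norm almost 2, so
  uniform convexity forces them to be close. Applied to a maximizing sequence this yields
  existence, applied to two functionals it yields uniqueness and continuity.\<close>

lemma near_norming_vectors_close:
  assumes convex: "uniformly_convex TYPE('v::real_normed_vector)" and "\<epsilon> > 0"
  obtains d where "d > 0"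
    "\<And>(\<phi>::'v \<Rightarrow>\<^sub>L real) u v. \<lbrakk>norm \<phi> = 1; norm u = 1; norm v = 1; blinfun_apply \<phi> u > 1 - d; blinfun_apply \<phi> v > 1 - d\<rbrakk>
       \<Longrightarrow> norm (u - v) < \<epsilon>"
proof -
  obtain d where d: "d > 0"
    "\<And>u v :: 'v. norm u = 1 \<Longrightarrow> norm v = 1 \<Longrightarrow> norm (u + v) > 2 - d \<Longrightarrow> norm (u - v) < \<epsilon>"
    using uniformly_convexE[OF assms] by metis
  have "norm (u - v) < \<epsilon>"
    if *: "norm \<phi> = 1" "norm u = 1" "norm v = 1" "blinfun_apply \<phi> u > 1 - d / 2" "blinfun_apply \<phi> v > 1 - d / 2"
    for \<phi> :: "'v \<Rightarrow>\<^sub>L real" and u v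
  proof (rule d(2))
    have "\<phi> (u + v) \<le> norm (u + v)" using norm_blinfun[of \<phi> "u + v"] * by simp
    then show "norm (u + v) > 2 - d" using * by (simp add: blinfun.add_right)
  qed (use * in auto)
  then show ?thesis using that[of "d / 2"] d by auto
qed

lemma norming_vector_exists:
  fixes \<phi> :: "'v::banach \<Rightarrow>\<^sub>L real"
  assumes convex: "uniformly_convex TYPE('v)" and \<phi>: "norm \<phi> = 1"
  shows "\<exists>u. norm u = 1 \<and> blinfun_apply \<phi> u = 1"
proof -
  have "\<exists>u. norm u = 1 \<and> \<phi> u > 1 - 1 / real (Suc n)" for n
    by (rule near_norming_vector[of "1 - 1 / real (Suc n)" \<phi>]) (use \<phi> in auto)
  then obtain u where u: "\<And>n. norm (u n) = 1" "\<And>n. \<phi> (u n) > 1 - 1 / real (Suc n)" by metis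
  have "Cauchy u"
  proof (rule metric_CauchyI)
    fix e :: real assume "e > 0"
    then obtain d where d: "d > 0"
      "\<And>(\<phi>::'v \<Rightarrow>\<^sub>L real) u v. \<lbrakk>norm \<phi> = 1; norm u = 1; norm v = 1; blinfun_apply \<phi> u > 1 - d; blinfun_apply \<phi> v > 1 - d\<rbrakk>
         \<Longrightarrow> norm (u - v) < e"
      using near_norming_vectors_close[OF convex] by metis
    obtain N where N: "1 / real (Suc N) < d" using nat_approx_posE d(1) by blast
    have "\<phi> (u n) > 1 - d" if "n \<ge> N" for n
    proof -
      have "1 / real (Suc n) \<le> 1 / real (Suc N)" using that by (intro divide_left_mono) auto
      then show ?thesis using u(2)[of n] N by linarith
    qed
    then show "\<exists>M. \<forall>m\<ge>M. \<forall>n\<ge>M. dist (u m) (u n) < e"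
      using d(2)[OF \<phi> u(1) u(1)] by (metis dist_norm)
  qed
  then obtain l where l: "u \<longlonglongrightarrow> l" by (auto simp: Cauchy_convergent_iff convergent_def)
  have "(\<lambda>n. norm (u n)) \<longlonglongrightarrow> norm l" by (intro tendsto_intros l)
  then have l1: "norm l = 1" using u(1) by (simp add: LIMSEQ_const_iff)
  have "(\<lambda>n. \<phi> (u n)) \<longlonglongrightarrow> \<phi> l" by (intro tendsto_intros l)
  moreover have "(\<lambda>n. 1 - 1 / real (Suc n)) \<longlonglongrightarrow> 1 - 0"
    by (intro tendsto_intros LIMSEQ_Suc[OF lim_1_over_n])
  ultimately have "1 - 0 \<le> \<phi> l"
    by (intro LIMSEQ_le[of "\<lambda>n. 1 - 1 / real (Suc n)" _ "\<lambda>n. \<phi> (u n)"]) (use u(2) in \<open>auto intro: less_imp_le\<close>)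
  moreover have "\<phi> l \<le> 1" using norm_blinfun[of \<phi> l] \<phi> l1 by simp
  ultimately show ?thesis using l1 by (intro exI[of _ l]) auto
qed

definition norming_vector :: "('v::real_normed_vector \<Rightarrow>\<^sub>L real) \<Rightarrow> 'v" where
  "norming_vector \<phi> = (THE u. norm u = 1 \<and> blinfun_apply \<phi> u = 1)"

lemma norming_vector_unique:
  fixes \<phi> :: "'v::real_normed_vector \<Rightarrow>\<^sub>L real"
  assumes convex: "uniformly_convex TYPE('v)" and \<phi>: "norm \<phi> = 1"
    and "norm u = 1" "blinfun_apply \<phi> u = 1" "norm v = 1" "blinfun_apply \<phi> v = 1"
  shows "u = v"
proof -
  have "norm (u - v) \<le> 0 + e" if "e > 0" for e
    using near_norming_vectors_close[OF convex that] assms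
    by (metis add_0 diff_less_eq less_add_same_cancel1 less_eq_real_def)
  then have "norm (u - v) \<le> 0" by (rule field_le_epsilon)
  then show ?thesis by simp
qed

lemma norming_vector:
  fixes \<phi> :: "'v::banach \<Rightarrow>\<^sub>L real"
  assumes convex: "uniformly_convex TYPE('v)" and \<phi>: "norm \<phi> = 1"
  shows "norm (norming_vector \<phi>) = 1" "\<phi> (norming_vector \<phi>) = 1"
proof -
  have "\<exists>!u. norm u = 1 \<and> blinfun_apply \<phi> u = 1"
    using norming_vector_exists[OF assms] norming_vector_unique[OF assms] by blast
  from theI'[OF this] show "norm (norming_vector \<phi>) = 1" "\<phi> (norming_vector \<phi>) = 1"
    unfolding norming_vector_def by auto
qed

lemma continuous_on_norming_vector:
  assumes convex: "uniformly_convex TYPE('v::banach)"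
  shows "continuous_on (sphere (0 :: 'v \<Rightarrow>\<^sub>L real) 1) norming_vector"
  unfolding continuous_on_iff
proof (intro ballI allI impI)
  fix \<phi> :: "'v \<Rightarrow>\<^sub>L real" and e :: real assume \<phi>: "\<phi> \<in> sphere 0 1" and "0 < e"
  then obtain d where d: "d > 0"
    "\<And>(\<phi>::'v \<Rightarrow>\<^sub>L real) u v. \<lbrakk>norm \<phi> = 1; norm u = 1; norm v = 1; blinfun_apply \<phi> u > 1 - d; blinfun_apply \<phi> v > 1 - d\<rbrakk>
       \<Longrightarrow> norm (u - v) < e"
    using near_norming_vectors_close[OF convex] by metis
  show "\<exists>d>0. \<forall>\<psi>\<in>sphere 0 1. dist \<psi> \<phi> < d \<longrightarrow> dist (norming_vector \<psi>) (norming_vector \<phi>) < e"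
  proof (intro exI[of _ d] conjI ballI impI d(1))
    fix \<psi> :: "'v \<Rightarrow>\<^sub>L real" assume \<psi>: "\<psi> \<in> sphere 0 1" "dist \<psi> \<phi> < d"
    let ?u = "norming_vector \<psi>" and ?v = "norming_vector \<phi>"
    have u: "norm ?u = 1" "\<psi> ?u = 1" and v: "norm ?v = 1" "\<phi> ?v = 1"
      using norming_vector[OF convex] \<phi> \<psi> by auto
    have "(\<psi> - \<phi>) ?u < d"
      using norm_blinfun[of "\<psi> - \<phi>" ?u] u \<psi>(2) by (simp add: dist_norm)
    then have "\<phi> ?u > 1 - d" using u by (simp add: blinfun.diff_left)
    then have "norm (?u - ?v) < e" using u v \<phi> d(1) by (intro d(2)[of \<phi>]) auto
    then show "dist ?u ?v < e" by (simp add: dist_norm)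
  qed
qed

lemma dual_duality_map_eq:
  fixes \<xi> :: "'v::banach \<Rightarrow>\<^sub>L real"
  assumes convex: "uniformly_convex TYPE('v)" and \<xi>: "\<xi> \<noteq> 0"
  shows "dual_duality_map q \<xi> = norm \<xi> powr (q - 1) *\<^sub>R norming_vector (sgn \<xi>)"
  unfolding dual_duality_map_def
proof (rule the_equality)
  have sgn1: "norm (sgn \<xi>) = 1" using \<xi> by (simp add: norm_sgn)
  have gauge: "norm \<xi> powr (q - 1) * norm \<xi> = norm \<xi> powr q"
    using \<xi> by (simp add: powr_diff)
  have "(norm \<xi> *\<^sub>R sgn \<xi>) (norming_vector (sgn \<xi>)) = norm \<xi>"
    using norming_vector(2)[OF convex sgn1] by (simp add: blinfun.scaleR_left)
  then have "\<xi> (norming_vector (sgn \<xi>)) = norm \<xi>" using \<xi> by (simp add: sgn_div_norm)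
  then show "norm (norm \<xi> powr (q - 1) *\<^sub>R norming_vector (sgn \<xi>)) = norm \<xi> powr (q - 1) \<and>
      \<xi> (norm \<xi> powr (q - 1) *\<^sub>R norming_vector (sgn \<xi>)) = norm \<xi> powr q"
    using norming_vector(1)[OF convex sgn1] gauge by (simp add: blinfun.scaleR_right)
  fix v assume v: "norm v = norm \<xi> powr (q - 1) \<and> \<xi> v = norm \<xi> powr q"
  let ?n = "norm \<xi> powr (q - 1)"
  have n: "?n > 0" using \<xi> by simp
  have "sgn \<xi> (inverse ?n *\<^sub>R v) = 1"
    using v n \<xi> gauge by (simp add: sgn_div_norm blinfun.scaleR_left blinfun.scaleR_right field_simps)
  moreover have "norm (inverse ?n *\<^sub>R v) = 1" using v n by simp
  ultimately have "inverse ?n *\<^sub>R v = norming_vector (sgn \<xi>)"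
    using norming_vector_unique[OF convex sgn1] norming_vector[OF convex sgn1] by blast
  then show "v = ?n *\<^sub>R norming_vector (sgn \<xi>)" using n by (metis less_irrefl scaleR_scaleR right_inverse scaleR_one)
qed

lemma dual_duality_map_zero: "dual_duality_map q (0::'v::real_normed_vector \<Rightarrow>\<^sub>L real) = 0"
  unfolding dual_duality_map_def by (rule the_equality) auto

lemma dual_duality_map_pairing:
  fixes \<xi> :: "'v::banach \<Rightarrow>\<^sub>L real"
  assumes convex: "uniformly_convex TYPE('v)"
  shows "\<xi> (dual_duality_map q \<xi>) = norm \<xi> powr q"
proof (cases "\<xi> = 0")
  case False
  have sgn1: "norm (sgn \<xi>) = 1" using False by (simp add: norm_sgn)
  have "(norm \<xi> *\<^sub>R sgn \<xi>) (norming_vector (sgn \<xi>)) = norm \<xi>"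
    using norming_vector(2)[OF convex sgn1] by (simp add: blinfun.scaleR_left)
  then have "\<xi> (norming_vector (sgn \<xi>)) = norm \<xi>" using False by (simp add: sgn_div_norm)
  then show ?thesis
    using False by (simp add: dual_duality_map_eq[OF convex False] blinfun.scaleR_right powr_diff)
qed (simp add: blinfun.zero_left)

lemma continuous_on_dual_duality_map:
  assumes convex: "uniformly_convex TYPE('v::banach)"
  shows "continuous_on (- {0 :: 'v \<Rightarrow>\<^sub>L real}) (dual_duality_map q)"
proof -
  have "continuous_on (- {0 :: 'v \<Rightarrow>\<^sub>L real}) (\<lambda>\<xi>. norm \<xi> powr (q - 1) *\<^sub>R norming_vector (sgn \<xi>))"
    by (intro continuous_intros continuous_on_compose2[OF continuous_on_norming_vector[OF convex]])
      (auto simp: norm_sgn split: if_splits)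
  then show ?thesis
    by (rule continuous_on_eq) (simp add: dual_duality_map_eq[OF convex])
qed

lemma tendsto_dual_duality_map:
  fixes f :: "'c \<Rightarrow> 'v::banach \<Rightarrow>\<^sub>L real"
  assumes convex: "uniformly_convex TYPE('v)" and f: "(f \<longlongrightarrow> l) net" and "l \<noteq> 0"
  shows "((\<lambda>t. dual_duality_map q (f t)) \<longlongrightarrow> dual_duality_map q l) net"
  using tendsto_imp_eventually_ne[OF f] assms(2,3)
  by (intro continuous_on_tendsto_compose[OF continuous_on_dual_duality_map[OF convex]]) auto


section \<open>The gradient of the conjugate of a p-convex functional\<close>

locale power_convex_functional =
  fixes \<Theta> :: "'a::banach \<Rightarrow> ereal" and p c :: real
  assumes proper: "proper_fun \<Theta>"
    and lsc: "lsc_fun \<Theta>"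
    and p_convex: "p_convex_fun p \<Theta>"
    and p_gt: "p > 1"
    and c_pos: "c > 0"
    and growth: "\<And>z x \<xi>. x \<in> subdiff_domain \<Theta> \<Longrightarrow> \<xi> \<in> subdifferential \<Theta> x \<Longrightarrow>
          bregman \<Theta> \<xi> z x \<ge> ereal (c * norm (z - x) powr p)"
    and subdiff_domain_nonempty: "subdiff_domain \<Theta> \<noteq> {}"
begin

definition \<theta> :: "'a \<Rightarrow> real" where
  "\<theta> x = real_of_ereal (\<Theta> x)"

lemma Theta_eq: "x \<in> effective_domain \<Theta> \<Longrightarrow> \<Theta> x = ereal (\<theta> x)"
  using proper unfolding proper_fun_def effective_domain_def \<theta>_def
  by (cases "\<Theta> x") auto

lemma effective_domain_iff: "x \<in> effective_domain \<Theta> \<longleftrightarrow> \<Theta> x \<noteq> \<infinity>"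
  by (auto simp: effective_domain_def)

lemma subdifferential_in_domain:
  assumes "\<xi> \<in> subdifferential \<Theta> x"
  shows "x \<in> effective_domain \<Theta>"
proof -
  obtain z where z: "z \<in> effective_domain \<Theta>" using proper by (auto simp: proper_fun_def)
  have "\<Theta> x + ereal (\<xi> (z - x)) \<le> \<Theta> z" using assms by (simp add: subdifferential_def)
  then show ?thesis using Theta_eq[OF z] by (auto simp: effective_domain_iff)
qed

lemma subdifferentialI:
  fixes \<xi> :: "'a \<Rightarrow>\<^sub>L real"
  assumes "x \<in> effective_domain \<Theta>"
    and "\<And>z. z \<in> effective_domain \<Theta> \<Longrightarrow> \<theta> x + \<xi> (z - x) \<le> \<theta> z"
  shows "\<xi> \<in> subdifferential \<Theta> x"
  unfolding subdifferential_def
proof (rule CollectI, rule allI)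
  fix z
  show "\<Theta> x + ereal (\<xi> (z - x)) \<le> \<Theta> z"
    using assms by (cases "z \<in> effective_domain \<Theta>") (auto simp: Theta_eq effective_domain_iff)
qed

lemma subgradient_growth:
  fixes \<xi> :: "'a \<Rightarrow>\<^sub>L real"
  assumes "\<xi> \<in> subdifferential \<Theta> x" "z \<in> effective_domain \<Theta>"
  shows "\<theta> x + \<xi> (z - x) + c * norm (z - x) powr p \<le> \<theta> z"
proof -
  have x: "x \<in> effective_domain \<Theta>" using assms subdifferential_in_domain by blast
  then have "x \<in> subdiff_domain \<Theta>" using assms by (auto simp: subdiff_domain_def)
  from growth[OF this assms(1), of z] show ?thesis
    using x assms by (simp add: bregman_def Theta_eq)
qed

text \<open>Adding the growth estimates in both directions; this is where the factor 2 in the step-size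
  condition comes from.\<close>

lemma subgradient_strongly_monotone:
  fixes \<xi> \<zeta> :: "'a \<Rightarrow>\<^sub>L real"
  assumes "\<xi> \<in> subdifferential \<Theta> x" "\<zeta> \<in> subdifferential \<Theta> z"
  shows "2 * c * norm (z - x) powr p \<le> (\<zeta> - \<xi>) (z - x)"
proof -
  have "\<theta> x + \<xi> (z - x) + c * norm (z - x) powr p \<le> \<theta> z"
    by (rule subgradient_growth) (use assms subdifferential_in_domain in auto)
  moreover have "\<theta> z + \<zeta> (x - z) + c * norm (x - z) powr p \<le> \<theta> x"
    by (rule subgradient_growth) (use assms subdifferential_in_domain in auto)
  moreover have "\<zeta> (x - z) = - \<zeta> (z - x)" by (simp add: blinfun.diff_right)
  ultimately show ?thesis by (simp add: norm_minus_commute blinfun.diff_left)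
qed

text \<open>The set-valued map inverse to the subdifferential is thereby single-valued and Hoelder continuous. It
  turns out to be the gradient of the conjugate.\<close>

lemma subgradient_inverse_holder:
  assumes "\<xi> \<in> subdifferential \<Theta> x" "\<zeta> \<in> subdifferential \<Theta> z"
  shows "norm (z - x) \<le> (norm (\<zeta> - \<xi>) / (2 * c)) powr (1 / (p - 1))"
proof (cases "z = x")
  case False
  let ?a = "norm (z - x)"
  have a: "?a > 0" using False by simp
  have "2 * c * ?a powr p \<le> norm (\<zeta> - \<xi>) * ?a"
    using subgradient_strongly_monotone[OF assms] norm_blinfun[of "\<zeta> - \<xi>" "z - x"] by simp
  moreover have "?a powr p = ?a powr (p - 1) * ?a" using a by (simp add: powr_diff)
  ultimately have "2 * c * ?a powr (p - 1) \<le> norm (\<zeta> - \<xi>)"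
    using a by (simp add: mult.assoc[symmetric])
  then have "?a powr (p - 1) \<le> norm (\<zeta> - \<xi>) / (2 * c)"
    using c_pos by (simp add: field_simps)
  then have "(?a powr (p - 1)) powr (1 / (p - 1)) \<le> (norm (\<zeta> - \<xi>) / (2 * c)) powr (1 / (p - 1))"
    using p_gt by (intro powr_mono2) auto
  then show ?thesis using a p_gt by (simp add: powr_powr)
qed simp

text \<open>A minimizing sequence of \<open>\<Theta> - \<xi>\<close> is Cauchy because p-convexity controls the distance of two points
  by the excess of their values over the value at the midpoint; its limit is a minimizer by lower
  semicontinuity.\<close>

lemma subgradient_surjective:
  fixes \<xi> :: "'a \<Rightarrow>\<^sub>L real"
  shows "\<exists>x. \<xi> \<in> subdifferential \<Theta> x"
proof -
  obtain x0 and \<xi>0 :: "'a \<Rightarrow>\<^sub>L real" where x0: "\<xi>0 \<in> subdifferential \<Theta> x0"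
    using subdiff_domain_nonempty by (auto simp: subdiff_domain_def)
  have x0_dom: "x0 \<in> effective_domain \<Theta>" using subdifferential_in_domain[OF x0] .
  define f where "f z = \<theta> z - \<xi> z" for z
  define K where "K = norm (\<xi> - \<xi>0)"
  define A where "A = (K / c) powr (1 / (p - 1))"
  have K: "K \<ge> 0" by (simp add: K_def)
  \<comment> \<open>Beyond radius \<open>A\<close> around \<open>x0\<close> the growth term dominates the linear term.\<close>
  have lower: "f x0 - K * A \<le> f z" if z: "z \<in> effective_domain \<Theta>" for z
  proof -
    let ?a = "norm (z - x0)"
    have "\<theta> x0 + \<xi>0 (z - x0) + c * ?a powr p \<le> \<theta> z" by (rule subgradient_growth[OF x0 z])
    moreover have "(\<xi> - \<xi>0) (z - x0) \<le> K * ?a"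
      using norm_blinfun[of "\<xi> - \<xi>0" "z - x0"] by (simp add: K_def)
    moreover have "K * ?a - K * A \<le> c * ?a powr p"
    proof (cases "?a \<le> A")
      case True
      then have "K * ?a \<le> K * A" using K by (intro mult_left_mono)
      moreover have "0 \<le> c * ?a powr p" using c_pos by simp
      ultimately show ?thesis by linarith
    next
      case False
      have a: "?a > 0" using False by (smt (verit) A_def powr_ge_zero)
      have "A powr (p - 1) \<le> ?a powr (p - 1)"
        using False p_gt by (intro powr_mono2) (auto simp: A_def)
      moreover have "A powr (p - 1) = K / c"
        using K c_pos p_gt by (simp add: A_def powr_powr)
      ultimately have "K \<le> c * ?a powr (p - 1)" using c_pos by (simp add: field_simps)
      then have "K * ?a \<le> c * ?a powr (p - 1) * ?a" by (intro mult_right_mono) auto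
      also have "\<dots> = c * ?a powr p" using a by (simp add: powr_diff)
      finally show ?thesis using K by (smt (verit) A_def mult_nonneg_nonneg powr_ge_zero)
    qed
    ultimately show ?thesis by (simp add: f_def blinfun.diff_left blinfun.diff_right)
  qed
  define m where "m = (INF z\<in>effective_domain \<Theta>. f z)"
  have bdd: "bdd_below (f ` effective_domain \<Theta>)" by (intro bdd_belowI[of _ "f x0 - K * A"]) (use lower in auto)
  have m_le: "m \<le> f z" if "z \<in> effective_domain \<Theta>" for z
    unfolding m_def by (rule cINF_lower[OF bdd that])
  have "\<exists>z\<in>effective_domain \<Theta>. f z < m + 1 / real (Suc n)" for n
    using cInf_lessD[of "f ` effective_domain \<Theta>" "m + 1 / real (Suc n)"] x0_dom
    by (auto simp: m_def)
  then obtain u where u: "\<And>n. u n \<in> effective_domain \<Theta>" "\<And>n. f (u n) < m + 1 / real (Suc n)"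
    by metis
  obtain k where k: "k > 0" "\<And>x z \<gamma>. 0 \<le> \<gamma> \<Longrightarrow> \<gamma> \<le> 1 \<Longrightarrow>
      \<Theta> (\<gamma> *\<^sub>R z + (1 - \<gamma>) *\<^sub>R x) + ereal (\<gamma> * (1 - \<gamma>) * k * norm (z - x) powr p)
        \<le> ereal \<gamma> * \<Theta> z + ereal (1 - \<gamma>) * \<Theta> x"
    using p_convex unfolding p_convex_fun_def by auto
  have midpoint: "m + k / 4 * norm (z - x) powr p \<le> (f z + f x) / 2"
    if "z \<in> effective_domain \<Theta>" "x \<in> effective_domain \<Theta>" for z x
  proof -
    let ?w = "(1/2) *\<^sub>R z + (1/2) *\<^sub>R x"
    have *: "\<Theta> ?w + ereal (k / 4 * norm (z - x) powr p) \<le> ereal ((\<theta> z + \<theta> x) / 2)"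
      using k(2)[of "1/2" z x] that by (simp add: Theta_eq add_divide_distrib)
    then have w: "?w \<in> effective_domain \<Theta>" by (auto simp: effective_domain_iff)
    have "\<theta> ?w + k / 4 * norm (z - x) powr p \<le> (\<theta> z + \<theta> x) / 2"
      using * by (simp add: Theta_eq[OF w])
    moreover have "\<xi> ?w = (\<xi> z + \<xi> x) / 2"
      by (simp add: blinfun.add_right blinfun.scaleR_right add_divide_distrib)
    ultimately show ?thesis using m_le[OF w] by (simp add: f_def field_simps)
  qed
  have "Cauchy u"
  proof (rule metric_CauchyI)
    fix e :: real assume e: "e > 0"
    then have "k / 4 * e powr p > 0" using k by simp
    then obtain N where N: "1 / real (Suc N) < k / 4 * e powr p" using nat_approx_posE by blast
    have "norm (u i - u j) < e" if "i \<ge> N" "j \<ge> N" for i j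
    proof -
      have "1 / real (Suc i) \<le> 1 / real (Suc N)" "1 / real (Suc j) \<le> 1 / real (Suc N)"
        using that by (auto intro!: divide_left_mono)
      then have "k / 4 * norm (u i - u j) powr p < k / 4 * e powr p"
        using midpoint[OF u(1)[of i] u(1)[of j]] u(2)[of i] u(2)[of j] N by argo
      then have "norm (u i - u j) powr p < e powr p" using k by simp
      then show ?thesis using e p_gt by (smt (verit) powr_mono2)
    qed
    then show "\<exists>M. \<forall>i\<ge>M. \<forall>j\<ge>M. dist (u i) (u j) < e" by (metis dist_norm)
  qed
  then obtain x where x: "u \<longlonglongrightarrow> x" by (auto simp: Cauchy_convergent_iff convergent_def)
  have "\<Theta> x \<le> ereal (m + \<xi> x)"
  proof (rule ccontr)
    assume "\<not> \<Theta> x \<le> ereal (m + \<xi> x)"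
    then have "ereal (m + \<xi> x) < \<Theta> x" by simp
    then obtain l where l: "ereal (m + \<xi> x) < ereal l" "ereal l < \<Theta> x"
      using ereal_dense2 by blast
    have "ereal l < Liminf (at x) \<Theta>"
      using l lsc unfolding lsc_fun_def by (meson order_less_le_trans)
    then have "\<forall>\<^sub>F z in at x. ereal l < \<Theta> z" by (rule less_LiminfD)
    then have "\<forall>\<^sub>F z in nhds x. ereal l < \<Theta> z"
      unfolding eventually_at_filter by (rule eventually_mono) (use l in auto)
    then have "\<forall>\<^sub>F n in sequentially. ereal l < \<Theta> (u n)"
      by (rule eventually_compose_filterlim[OF _ x])
    then have "\<forall>\<^sub>F n in sequentially. l \<le> m + 1 / real (Suc n) + \<xi> (u n)"
    proof (rule eventually_mono)
      fix n assume "ereal l < \<Theta> (u n)"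
      then show "l \<le> m + 1 / real (Suc n) + \<xi> (u n)"
        using u(1)[of n] u(2)[of n] by (simp add: Theta_eq f_def)
    qed
    moreover have "(\<lambda>n. m + 1 / real (Suc n) + \<xi> (u n)) \<longlonglongrightarrow> m + 0 + \<xi> x"
      by (intro tendsto_intros LIMSEQ_Suc[OF lim_1_over_n] x)
    ultimately have "l \<le> m + 0 + \<xi> x" by (intro tendsto_lowerbound) auto
    then show False using l by simp
  qed
  then have x_dom: "x \<in> effective_domain \<Theta>" by (auto simp: effective_domain_iff)
  then have "\<theta> x \<le> m + \<xi> x" using \<open>\<Theta> x \<le> ereal (m + \<xi> x)\<close> by (simp add: Theta_eq)
  then have "\<xi> \<in> subdifferential \<Theta> x"
  proof (intro subdifferentialI x_dom)
    fix z assume "z \<in> effective_domain \<Theta>"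
    with m_le[OF this] \<open>\<theta> x \<le> m + \<xi> x\<close> show "\<theta> x + \<xi> (z - x) \<le> \<theta> z"
      by (simp add: f_def blinfun.diff_right)
  qed
  then show ?thesis ..
qed

lemma conjugate_eq:
  fixes \<xi> :: "'a \<Rightarrow>\<^sub>L real"
  assumes "\<xi> \<in> subdifferential \<Theta> x"
  shows "conjugate \<Theta> \<xi> = ereal (\<xi> x - \<theta> x)"
  unfolding conjugate_def
proof (rule antisym)
  have x: "x \<in> effective_domain \<Theta>" using assms subdifferential_in_domain by blast
  show "(SUP z. ereal (\<xi> z) - \<Theta> z) \<le> ereal (\<xi> x - \<theta> x)"
  proof (rule SUP_least)
    fix z
    have "\<Theta> x + ereal (\<xi> (z - x)) \<le> \<Theta> z" using assms by (simp add: subdifferential_def)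
    then show "ereal (\<xi> z) - \<Theta> z \<le> ereal (\<xi> x - \<theta> x)"
      using x by (cases "\<Theta> z") (auto simp: Theta_eq blinfun.diff_right)
  qed
  show "ereal (\<xi> x - \<theta> x) \<le> (SUP z. ereal (\<xi> z) - \<Theta> z)"
    by (rule SUP_upper2[of x]) (use x in \<open>auto simp: Theta_eq\<close>)
qed

text \<open>If \<open>\<omega>\<close> is a subgradient at \<open>z\<close>, the linearization error of the conjugate lies between 0 and
  \<open>(\<omega> - \<xi>) (z - x)\<close>, which is \<open>o(\<omega> - \<xi>)\<close> since the subgradient determines its base point Hoelder
  continuously.\<close>

lemma has_conjugate_gradient_subgradient:
  fixes \<xi> :: "'a \<Rightarrow>\<^sub>L real"
  assumes x: "\<xi> \<in> subdifferential \<Theta> x"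
  shows "has_conjugate_gradient \<Theta> \<xi> x"
  unfolding has_conjugate_gradient_def
proof
  have finite: "\<bar>conjugate \<Theta> \<omega>\<bar> \<noteq> \<infinity>" for \<omega>
    using subgradient_surjective[of \<omega>] conjugate_eq by auto
  then show "\<forall>\<^sub>F \<omega> in nhds \<xi>. \<bar>conjugate \<Theta> \<omega>\<bar> \<noteq> \<infinity>" by simp
  let ?g = "\<lambda>\<omega>. real_of_ereal (conjugate \<Theta> \<omega>)"
  let ?e = "\<lambda>\<omega>. (norm (\<omega> - \<xi>) / (2 * c)) powr (1 / (p - 1))"
  have err: "norm (?g \<omega> - ?g \<xi> - (\<omega> - \<xi>) x) \<le> norm (\<omega> - \<xi>) * ?e \<omega>" for \<omega> :: "'a \<Rightarrow>\<^sub>L real"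
  proof -
    obtain z where z: "\<omega> \<in> subdifferential \<Theta> z" using subgradient_surjective by blast
    have "\<theta> x + \<xi> (z - x) + c * norm (z - x) powr p \<le> \<theta> z"
      by (rule subgradient_growth) (use x z subdifferential_in_domain in auto)
    moreover have "\<theta> z + \<omega> (x - z) + c * norm (x - z) powr p \<le> \<theta> x"
      by (rule subgradient_growth) (use x z subdifferential_in_domain in auto)
    moreover have "0 \<le> c * norm (z - x) powr p" "0 \<le> c * norm (x - z) powr p" using c_pos by auto
    ultimately have "\<bar>?g \<omega> - ?g \<xi> - (\<omega> - \<xi>) x\<bar> \<le> (\<omega> - \<xi>) (z - x)"
      unfolding conjugate_eq[OF x] conjugate_eq[OF z] real_of_ereal.simps blinfun.diff_left blinfun.diff_right
      by linarith
    also have "\<dots> \<le> norm (\<omega> - \<xi>) * norm (z - x)" using norm_blinfun[of "\<omega> - \<xi>" "z - x"] by simp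
    also have "\<dots> \<le> norm (\<omega> - \<xi>) * ?e \<omega>"
      by (intro mult_left_mono subgradient_inverse_holder[OF x z]) auto
    finally show ?thesis by simp
  qed
  show "(?g has_derivative (\<lambda>h. blinfun_apply h x)) (at \<xi>)"
    unfolding has_derivative_within
  proof
    show "bounded_linear (\<lambda>h. blinfun_apply h x)" by (rule blinfun.bounded_linear_left)
    have "(?e \<longlongrightarrow> (norm (\<xi> - \<xi>) / (2 * c)) powr (1 / (p - 1))) (at \<xi>)"
      using c_pos p_gt by (intro tendsto_intros) (auto intro!: always_eventually)
    then have e0: "(?e \<longlongrightarrow> 0) (at \<xi>)" by simp
    show "((\<lambda>\<omega>. (1 / norm (\<omega> - \<xi>)) *\<^sub>R (?g \<omega> - (?g \<xi> + (\<omega> - \<xi>) x))) \<longlongrightarrow> 0) (at \<xi>)"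
    proof (rule Lim_null_comparison[OF _ e0], rule always_eventually, rule allI)
      fix \<omega>
      show "norm ((1 / norm (\<omega> - \<xi>)) *\<^sub>R (?g \<omega> - (?g \<xi> + (\<omega> - \<xi>) x))) \<le> ?e \<omega>"
        using err[of \<omega>] by (cases "\<omega> = \<xi>") (simp_all add: field_simps)
    qed
  qed
qed

end

text \<open>The gradient of the conjugate is specified through its pairings with functionals, so identifying it
  requires that functionals separate points. The duality mapping supplies enough of them.\<close>

lemma functionals_separate_points:
  fixes x z :: "'v::real_normed_vector"
  assumes smooth: "uniformly_smooth TYPE('v)"
    and "\<And>\<phi> :: 'v \<Rightarrow>\<^sub>L real. blinfun_apply \<phi> x = blinfun_apply \<phi> z"
  shows "x = z"
proof -
  have "norm (x - z) powr 2 = duality_map 2 (x - z) (x - z)"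
    by (simp add: duality_map_self[OF smooth])
  also have "\<dots> = 0" by (simp add: blinfun.diff_right assms(2))
  finally show ?thesis by simp
qed

lemma (in power_convex_functional) grad_conjugate_eq:
  assumes smooth: "uniformly_smooth TYPE('a)" and x: "\<xi> \<in> subdifferential \<Theta> x"
  shows "grad_conjugate \<Theta> \<xi> = x"
  unfolding grad_conjugate_def
proof (rule the_equality)
  show "has_conjugate_gradient \<Theta> \<xi> x" using has_conjugate_gradient_subgradient[OF x] .
  fix z assume "has_conjugate_gradient \<Theta> \<xi> z"
  then have dz: "((\<lambda>\<omega>. real_of_ereal (conjugate \<Theta> \<omega>)) has_derivative (\<lambda>h. blinfun_apply h z)) (at \<xi>)"
    unfolding has_conjugate_gradient_def by (rule conjunct2)
  have dx: "((\<lambda>\<omega>. real_of_ereal (conjugate \<Theta> \<omega>)) has_derivative (\<lambda>h. blinfun_apply h x)) (at \<xi>)"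
    using has_conjugate_gradient_subgradient[OF x]
    unfolding has_conjugate_gradient_def by (rule conjunct2)
  have "(\<lambda>h :: 'a \<Rightarrow>\<^sub>L real. blinfun_apply h z) = (\<lambda>h. blinfun_apply h x)"
    using has_derivative_unique[OF dz dx] .
  then show "z = x" by (intro functionals_separate_points[OF smooth]) (rule fun_cong)
qed

lemma (in power_convex_functional) subgradient_grad_conjugate:
  assumes smooth: "uniformly_smooth TYPE('a)"
  shows "\<xi> \<in> subdifferential \<Theta> (grad_conjugate \<Theta> \<xi>)"
  using subgradient_surjective[of \<xi>] grad_conjugate_eq[OF smooth] by auto

lemma (in power_convex_functional) tendsto_grad_conjugate:
  assumes smooth: "uniformly_smooth TYPE('a)" and f: "(f \<longlongrightarrow> \<xi>) net"
  shows "((\<lambda>t. grad_conjugate \<Theta> (f t)) \<longlongrightarrow> grad_conjugate \<Theta> \<xi>) net"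
proof -
  have "((\<lambda>t. (norm (f t - \<xi>) / (2 * c)) powr (1 / (p - 1))) \<longlongrightarrow>
      (norm (\<xi> - \<xi>) / (2 * c)) powr (1 / (p - 1))) net"
    using c_pos p_gt by (intro tendsto_intros f) (auto intro!: always_eventually)
  then have e: "((\<lambda>t. (norm (f t - \<xi>) / (2 * c)) powr (1 / (p - 1))) \<longlongrightarrow> 0) net" by simp
  have "((\<lambda>t. grad_conjugate \<Theta> (f t) - grad_conjugate \<Theta> \<xi>) \<longlongrightarrow> 0) net"
    by (rule Lim_null_comparison[OF _ e])
      (intro always_eventually allI subgradient_inverse_holder subgradient_grad_conjugate smooth)
  then show ?thesis by (rule LIM_zero_cancel)
qed


section \<open>Bregman distances along the iteration\<close>

text \<open>The change of the Bregman distance to \<open>z\<close> is exactly \<open>(\<xi> - \<xi>') (z - x) + (\<xi>' - \<xi>) (x' - x)\<close> minus the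
  Bregman distance from \<open>x\<close> to \<open>x'\<close>, which is nonnegative. The first term is linear in the update and
  can be made negative; the second is of order \<open>p / (p - 1)\<close> in its norm.\<close>

lemma (in power_convex_functional) bregman_update_le:
  fixes \<xi> \<xi>' :: "'a \<Rightarrow>\<^sub>L real"
  assumes x: "\<xi> \<in> subdifferential \<Theta> x" and x': "\<xi>' \<in> subdifferential \<Theta> x'"
  shows "\<theta> z - \<theta> x' - \<xi>' (z - x') \<le> \<theta> z - \<theta> x - \<xi> (z - x) + (\<xi> - \<xi>') (z - x)
    + norm (\<xi>' - \<xi>) * (norm (\<xi>' - \<xi>) / (2 * c)) powr (1 / (p - 1))"
proof -
  have "\<theta> x + \<xi> (x' - x) + c * norm (x' - x) powr p \<le> \<theta> x'"
    by (rule subgradient_growth[OF x subdifferential_in_domain[OF x']])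
  moreover have "0 \<le> c * norm (x' - x) powr p" using c_pos by simp
  moreover have "(\<xi>' - \<xi>) (x' - x) \<le> norm (\<xi>' - \<xi>) * norm (x' - x)"
    using norm_blinfun[of "\<xi>' - \<xi>" "x' - x"] by simp
  moreover have "\<dots> \<le> norm (\<xi>' - \<xi>) * (norm (\<xi>' - \<xi>) / (2 * c)) powr (1 / (p - 1))"
    by (intro mult_left_mono subgradient_inverse_holder[OF x x']) auto
  ultimately show ?thesis
    unfolding blinfun.diff_left blinfun.diff_right by linarith
qed

text \<open>The direction is kept in the dual of the data space, before the adjoint of \<open>F' x\<close> is applied, because the
  descent estimate pairs it with \<open>F' x (z - x)\<close>.\<close>

definition search_direction ::
  "('a::real_normed_vector \<Rightarrow> 'b::real_normed_vector) \<Rightarrow> ('a \<Rightarrow> 'a \<Rightarrow>\<^sub>L 'b) \<Rightarrow> real \<Rightarrow> real \<Rightarrow> 'b \<Rightarrow> 'a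
    \<Rightarrow> 'b \<Rightarrow>\<^sub>L real" where
  "search_direction F F' r q v x =
     (let res = duality_map r (F x - v);
          w = duality_map r (F' x (dual_duality_map q (dual_op (F' x) res)))
      in 2 *\<^sub>R res - (norm res / norm w) *\<^sub>R w)"

definition step_size :: "real \<Rightarrow> real \<Rightarrow> real \<Rightarrow> real \<Rightarrow> real \<Rightarrow> real \<Rightarrow> real \<Rightarrow> real" where
  "step_size p r \<mu>\<^sub>0 B\<^sub>0 \<tau> \<delta> d =
     (if d > \<tau> * \<delta> then \<mu>\<^sub>0 * B\<^sub>0 powr (- p) * d powr (p - r) else 0)"

lemma iteration_step_eq:
  "iteration_step F F' \<Theta> p r q \<mu>\<^sub>0 B\<^sub>0 \<tau> \<delta> v (x, \<xi>) =
     (let \<xi>' = \<xi> - step_size p r \<mu>\<^sub>0 B\<^sub>0 \<tau> \<delta> (norm (F x - v)) *\<^sub>R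
                   dual_op (F' x) (search_direction F F' r q v x)
      in (grad_conjugate \<Theta> \<xi>', \<xi>'))"
  by (simp add: iteration_step_def search_direction_def step_size_def Let_def)

lemma norm_search_direction_le:
  fixes F :: "'a::real_normed_vector \<Rightarrow> 'b::real_normed_vector"
    and F' :: "'a \<Rightarrow> 'a \<Rightarrow>\<^sub>L 'b"
  assumes smooth: "uniformly_smooth TYPE('b)"
  shows "norm (search_direction F F' r q v x) \<le> 3 * norm (F x - v) powr (r - 1)"
proof -
  let ?res = "duality_map r (F x - v)"
  let ?w = "duality_map r (F' x (dual_duality_map q (dual_op (F' x) ?res)))"
  have "norm ((norm ?res / norm ?w) *\<^sub>R ?w) \<le> norm ?res" by simp
  then have "norm (2 *\<^sub>R ?res - (norm ?res / norm ?w) *\<^sub>R ?w) \<le> 2 * norm ?res + norm ?res"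
    using norm_triangle_ineq4[of "2 *\<^sub>R ?res" "(norm ?res / norm ?w) *\<^sub>R ?w"] by simp
  then have "norm (search_direction F F' r q v x) \<le> 3 * norm ?res"
    by (simp add: search_direction_def Let_def)
  then show ?thesis by (simp only: norm_duality_map[OF smooth])
qed

text \<open>The tangential cone condition makes \<open>F' x (z - x)\<close> agree with minus the residual up to the noise and
  a fraction \<open>\<eta>\<close> of the residual. The term \<open>2 res\<close> contributes \<open>-2 d\<^sup>r\<close>, and the second direction, of norm at
  most \<open>d\<^bsup>r-1\<^esup>\<close> whatever it is, takes back at most one \<open>d\<^sup>r\<close>; the errors occur three times.\<close>

lemma search_direction_descent:
  fixes F :: "'a::real_normed_vector \<Rightarrow> 'b::real_normed_vector"
    and F' :: "'a \<Rightarrow> 'a \<Rightarrow>\<^sub>L 'b"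
  assumes smooth: "uniformly_smooth TYPE('b)"
    and tcc: "norm (y - F x - F' x (z - x)) \<le> \<eta> * norm (y - F x)"
    and noise: "norm (y - v) \<le> \<delta>" and large: "norm (F x - v) > \<tau> * \<delta>"
    and \<tau>: "\<tau> > 0" and \<eta>: "\<eta> \<ge> 0"
  shows "search_direction F F' r q v x (F' x (z - x))
    \<le> - ((1 - 3 * \<eta> - 3 * (\<eta> + 1) / \<tau>) * norm (F x - v) powr r)"
proof -
  define d where "d = norm (F x - v)"
  define M where "M = d powr (r - 1)"
  define e where "e = F' x (z - x)"
  define E where "E = y - F x - e"
  define res where "res = duality_map r (F x - v)"
  define w where "w = duality_map r (F' x (dual_duality_map q (dual_op (F' x) res)))"
  define w' where "w' = (norm res / norm w) *\<^sub>R w"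
  have "0 \<le> \<delta>" using noise norm_ge_zero order_trans by blast
  then have d: "d > 0" using large \<tau> by (smt (verit) d_def mult_nonneg_nonneg)
  have M: "M \<ge> 0" "M * d = d powr r" using d by (simp_all add: M_def powr_diff)
  have res: "norm res = M" "res (F x - v) = M * d"
    using M by (simp_all add: res_def M_def d_def duality_map[OF smooth])
  have w': "norm w' \<le> M" using res by (simp add: w'_def M)
  have res_le: "\<bar>res g\<bar> \<le> M * norm g" for g using norm_blinfun[of res g] res by simp
  have data: "norm (y - F x) \<le> d + \<delta>"
    using norm_triangle_ineq4[of "y - v" "F x - v"] noise by (simp add: d_def)
  have "norm E \<le> \<eta> * norm (y - F x)" using tcc by (simp add: E_def e_def)
  also have "\<dots> \<le> \<eta> * (d + \<delta>)" using data \<eta> by (rule mult_left_mono)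
  finally have E: "norm E \<le> \<eta> * (d + \<delta>)" .
  have "e = - (F x - v) + (y - v) - E" by (simp add: E_def)
  then have "res e = - (M * d) + res (y - v) - res E"
    using res by (simp only: blinfun.diff_right blinfun.add_right blinfun.minus_right)
  moreover have "res (y - v) \<le> M * \<delta>"
    using res_le[of "y - v"] mult_left_mono[OF noise M(1)] by linarith
  moreover have "- res E \<le> M * (\<eta> * (d + \<delta>))"
    using res_le[of E] mult_left_mono[OF E M(1)] by linarith
  ultimately have first: "res e \<le> M * (- d + \<delta> + \<eta> * (d + \<delta>))" by (simp add: algebra_simps)
  have "e = (y - F x) - E" by (simp add: E_def)
  then have "norm e \<le> (d + \<delta>) + \<eta> * (d + \<delta>)"
    using norm_triangle_ineq4[of "y - F x" E] data E by simp
  then have "\<bar>w' e\<bar> \<le> M * ((d + \<delta>) + \<eta> * (d + \<delta>))"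
    using norm_blinfun[of w' e] mult_mono[OF w' _ M(1) norm_ge_zero, of e] by (smt (verit) real_norm_def)
  then have "2 * res e - w' e \<le> M * (- d + 3 * \<eta> * d + 3 * (\<eta> + 1) * \<delta>)"
    using first by (simp add: algebra_simps)
  also have "\<dots> \<le> M * (- d + 3 * \<eta> * d + 3 * (\<eta> + 1) * (d / \<tau>))"
    using large \<tau> \<eta> M(1) by (intro mult_left_mono add_left_mono) (auto simp: d_def field_simps)
  also have "\<dots> = - ((1 - 3 * \<eta> - 3 * (\<eta> + 1) / \<tau>) * (M * d))" by (simp add: field_simps)
  finally show ?thesis
    unfolding M(2) search_direction_def Let_def res_def[symmetric] w_def[symmetric] e_def[symmetric]
      d_def[symmetric] w'_def
    by (simp add: blinfun.diff_left blinfun.scaleR_left)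
qed

lemma tendsto_dual_op:
  assumes "(A \<longlongrightarrow> a) net" "(\<zeta> \<longlongrightarrow> z) net"
  shows "((\<lambda>t. dual_op (A t) (\<zeta> t)) \<longlongrightarrow> dual_op a z) net"
  unfolding dual_op_def
  by (rule bounded_bilinear.tendsto[OF bounded_bilinear_blinfun_compose assms(2,1)])

locale landweber_iteration = power_convex_functional \<Theta> p c\<^sub>0
  for \<Theta> :: "'a::banach \<Rightarrow> ereal" and p c\<^sub>0 :: real +
  fixes F :: "'a \<Rightarrow> 'b::banach" and F' :: "'a \<Rightarrow> 'a \<Rightarrow>\<^sub>L 'b"
    and r q \<rho> B\<^sub>0 \<eta> \<tau> \<mu>\<^sub>0 :: real and x\<^sub>0 xdag :: 'a and \<xi>\<^sub>0 :: "'a \<Rightarrow>\<^sub>L real" and y :: 'b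
  assumes X_smooth: "uniformly_smooth TYPE('a)"
    and X_convex: "uniformly_convex TYPE('a)"
    and Y_smooth: "uniformly_smooth TYPE('b)"
    and xi0: "\<xi>\<^sub>0 \<in> subdifferential \<Theta> x\<^sub>0"
    and rho_pos: "\<rho> > 0"
    and F_cont: "continuous_on (cball x\<^sub>0 (2 * \<rho>)) F"
    and F'_cont: "continuous_on (cball x\<^sub>0 (2 * \<rho>)) F'"
    and B0_pos: "B\<^sub>0 > 0"
    and F'_bound: "\<And>x. x \<in> cball x\<^sub>0 (2 * \<rho>) \<Longrightarrow> norm (F' x) \<le> B\<^sub>0"
    and eta: "0 \<le> \<eta>" "\<eta> < 1"
    and tcc: "\<And>x z. x \<in> cball x\<^sub>0 (2 * \<rho>) \<Longrightarrow> z \<in> cball x\<^sub>0 (2 * \<rho>) \<Longrightarrow>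
          norm (F x - F z - F' z (x - z)) \<le> \<eta> * norm (F x - F z)"
    and xdag_sol: "xdag \<in> effective_domain \<Theta>" "F xdag = y"
    and xdag_close: "bregman \<Theta> \<xi>\<^sub>0 xdag x\<^sub>0 \<le> ereal (c\<^sub>0 * \<rho> powr p)"
    and tau_pos: "\<tau> > 0"
    and mu0_pos: "\<mu>\<^sub>0 > 0"
    and parameters: "1 - 3 * \<eta> - 3 * (\<eta> + 1) / \<tau>
          - 3 * (3 * \<mu>\<^sub>0 / (2 * c\<^sub>0)) powr (1 / (p - 1)) \<ge> 0"
begin

abbreviation step :: "real \<Rightarrow> 'b \<Rightarrow> 'a \<times> ('a \<Rightarrow>\<^sub>L real) \<Rightarrow> 'a \<times> ('a \<Rightarrow>\<^sub>L real)" where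
  "step \<equiv> iteration_step F F' \<Theta> p r q \<mu>\<^sub>0 B\<^sub>0 \<tau>"

abbreviation iter :: "real \<Rightarrow> 'b \<Rightarrow> nat \<Rightarrow> 'a \<times> ('a \<Rightarrow>\<^sub>L real)" where
  "iter \<equiv> iterates F F' \<Theta> p r q \<mu>\<^sub>0 B\<^sub>0 \<tau> x\<^sub>0 \<xi>\<^sub>0"

abbreviation update :: "real \<Rightarrow> 'b \<Rightarrow> 'a \<Rightarrow> 'a \<Rightarrow>\<^sub>L real" where
  "update \<delta> v x \<equiv> step_size p r \<mu>\<^sub>0 B\<^sub>0 \<tau> \<delta> (norm (F x - v)) *\<^sub>R
      dual_op (F' x) (search_direction F F' r q v x)"

text \<open>The bound holds whether or not the discrepancy test stops the iteration. It vanishes with the residual,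
  because the step size is scaled so that the powers of the residual add up to \<open>p - 1 > 0\<close>.\<close>

lemma norm_update_le:
  assumes x: "x \<in> cball x\<^sub>0 (2 * \<rho>)"
  shows "norm (update \<delta> v x) \<le> 3 * \<mu>\<^sub>0 * (norm (F x - v) / B\<^sub>0) powr (p - 1)"
proof (cases "F x = v")
  case True
  then show ?thesis
    using mu0_pos norm_search_direction_le[OF Y_smooth, of F F' r q v x] by (simp add: dual_op_def)
next
  case False
  define d where "d = norm (F x - v)"
  have d: "d > 0" using False by (simp add: d_def)
  have "norm (dual_op (F' x) (search_direction F F' r q v x)) \<le> (3 * d powr (r - 1)) * B\<^sub>0"
    unfolding dual_op_def d_def
    by (intro order_trans[OF norm_blinfun_compose] mult_mono norm_search_direction_le Y_smooth F'_bound x) auto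
  moreover have "\<bar>step_size p r \<mu>\<^sub>0 B\<^sub>0 \<tau> \<delta> d\<bar> \<le> \<mu>\<^sub>0 * B\<^sub>0 powr (- p) * d powr (p - r)"
    using mu0_pos by (simp add: step_size_def abs_mult)
  ultimately have "norm (update \<delta> v x) \<le>
      (\<mu>\<^sub>0 * B\<^sub>0 powr (- p) * d powr (p - r)) * ((3 * d powr (r - 1)) * B\<^sub>0)"
    unfolding norm_scaleR d_def[symmetric] using mu0_pos by (intro mult_mono) auto
  also have "\<dots> = 3 * \<mu>\<^sub>0 * (d / B\<^sub>0) powr (p - 1)"
    using d B0_pos by (simp add: powr_diff powr_minus powr_divide field_simps)
  finally show ?thesis by (simp add: d_def)
qed

text \<open>The Bregman distance to \<open>xdag\<close> starts below \<open>c\<^sub>0 \<rho>\<^sup>p\<close> and does not increase, and it dominates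
  \<open>c\<^sub>0 norm (xdag - x)\<^sup>p\<close>; so every iterate stays within \<open>\<rho>\<close> of \<open>xdag\<close>, which is within \<open>\<rho>\<close> of \<open>x\<^sub>0\<close>.\<close>

lemma dist_xdag_le_if_bregman_le:
  fixes \<xi> :: "'a \<Rightarrow>\<^sub>L real"
  assumes \<xi>: "\<xi> \<in> subdifferential \<Theta> x"
    and le: "\<theta> xdag - \<theta> x - \<xi> (xdag - x) \<le> \<theta> xdag - \<theta> x\<^sub>0 - \<xi>\<^sub>0 (xdag - x\<^sub>0)"
  shows "dist xdag x \<le> \<rho>"
proof -
  have x0: "x\<^sub>0 \<in> effective_domain \<Theta>" using subdifferential_in_domain[OF xi0] .
  have "\<theta> xdag - \<theta> x\<^sub>0 - \<xi>\<^sub>0 (xdag - x\<^sub>0) \<le> c\<^sub>0 * \<rho> powr p"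
    using xdag_close x0 xdag_sol(1) by (simp add: bregman_def Theta_eq)
  then have "c\<^sub>0 * norm (xdag - x) powr p \<le> c\<^sub>0 * \<rho> powr p"
    using subgradient_growth[OF \<xi> xdag_sol(1)] le by linarith
  then have "norm (xdag - x) powr p \<le> \<rho> powr p" using c_pos by simp
  then have "norm (xdag - x) \<le> \<rho>" using rho_pos p_gt by (smt (verit) powr_less_mono2)
  then show ?thesis by (simp add: dist_norm)
qed

lemma xdag_in_cball: "xdag \<in> cball x\<^sub>0 \<rho>"
  using dist_xdag_le_if_bregman_le[OF xi0] by (simp add: dist_commute)

text \<open>Measured in units of \<open>N = \<mu>\<^sub>0 B\<^sub>0\<^bsup>-p\<^esup> d\<^sup>p\<close>, the linear term gains \<open>1 - 3 \<eta> - 3 (\<eta> + 1) / \<tau>\<close> by the descent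
  property of the search direction, and the remainder costs at most \<open>3 \<kappa>\<close> by the norm bound of the
  update. The condition on the parameters is the statement that the gain outweighs the cost.\<close>

lemma bregman_step_le:
  assumes \<xi>: "\<xi> \<in> subdifferential \<Theta> x" and x: "x \<in> cball x\<^sub>0 (2 * \<rho>)"
    and noise: "norm (y - v) \<le> \<delta>"
    and x': "\<xi> - update \<delta> v x \<in> subdifferential \<Theta> x'"
  shows "\<theta> xdag - \<theta> x' - (\<xi> - update \<delta> v x) (xdag - x') \<le> \<theta> xdag - \<theta> x - \<xi> (xdag - x)"
proof -
  define d where "d = norm (F x - v)"
  define U where "U = update \<delta> v x"
  define \<kappa> where "\<kappa> = (3 * \<mu>\<^sub>0 / (2 * c\<^sub>0)) powr (1 / (p - 1))"
  have U: "norm U \<le> 3 * \<mu>\<^sub>0 * (d / B\<^sub>0) powr (p - 1)"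
    unfolding U_def d_def by (rule norm_update_le[OF x])
  have upd: "\<theta> xdag - \<theta> x' - (\<xi> - U) (xdag - x') \<le> \<theta> xdag - \<theta> x - \<xi> (xdag - x) + U (xdag - x)
      + norm U * (norm U / (2 * c\<^sub>0)) powr (1 / (p - 1))"
    using bregman_update_le[OF \<xi> x', of xdag] by (simp add: U_def)
  have "U (xdag - x) + norm U * (norm U / (2 * c\<^sub>0)) powr (1 / (p - 1)) \<le> 0"
  proof (cases "d > \<tau> * \<delta>")
    case False
    then have "U = 0" by (simp add: U_def d_def step_size_def)
    then show ?thesis by simp
  next
    case True
    have "0 \<le> \<delta>" using noise norm_ge_zero order_trans by blast
    then have d: "d > 0" using True tau_pos by (smt (verit) mult_nonneg_nonneg)
    define N where "N = \<mu>\<^sub>0 * B\<^sub>0 powr (- p) * d powr p"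
    have N: "N \<ge> 0" using mu0_pos by (simp add: N_def)
    have xdag: "xdag \<in> cball x\<^sub>0 (2 * \<rho>)" using xdag_in_cball rho_pos by auto
    define Q where "Q = 1 - 3 * \<eta> - 3 * (\<eta> + 1) / \<tau>"
    have "search_direction F F' r q v x (F' x (xdag - x)) \<le> - (Q * d powr r)"
      unfolding d_def Q_def
      by (rule search_direction_descent[OF Y_smooth _ noise])
        (use tcc[OF xdag x] xdag_sol(2) True tau_pos eta in \<open>auto simp: d_def\<close>)
    then have "(\<mu>\<^sub>0 * B\<^sub>0 powr (- p) * d powr (p - r)) * search_direction F F' r q v x (F' x (xdag - x))
        \<le> (\<mu>\<^sub>0 * B\<^sub>0 powr (- p) * d powr (p - r)) * (- (Q * d powr r))"
      using mu0_pos by (intro mult_left_mono) auto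
    also have "\<dots> = - (Q * N)" using d by (simp add: N_def powr_diff)
    finally have lin: "U (xdag - x) \<le> - (Q * N)"
      using True by (simp add: U_def d_def[symmetric] step_size_def dual_op_def blinfun.scaleR_left)
    have "(norm U / (2 * c\<^sub>0)) powr (1 / (p - 1))
        \<le> ((3 * \<mu>\<^sub>0 / (2 * c\<^sub>0)) * (d / B\<^sub>0) powr (p - 1)) powr (1 / (p - 1))"
      using U p_gt c_pos by (intro powr_mono2) (auto simp: field_simps)
    also have "\<dots> = \<kappa> * (d / B\<^sub>0)"
    proof -
      have "((d / B\<^sub>0) powr (p - 1)) powr (1 / (p - 1)) = d / B\<^sub>0"
        using p_gt d B0_pos by (simp add: powr_powr)
      then show ?thesis
        unfolding \<kappa>_def using c_pos mu0_pos by (subst powr_mult) simp_all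
    qed
    finally have "norm U * (norm U / (2 * c\<^sub>0)) powr (1 / (p - 1))
        \<le> (3 * \<mu>\<^sub>0 * (d / B\<^sub>0) powr (p - 1)) * (\<kappa> * (d / B\<^sub>0))"
      using U mu0_pos by (intro mult_mono) auto
    also have "\<dots> = 3 * \<kappa> * N"
      using d B0_pos by (simp add: N_def powr_diff powr_minus powr_divide field_simps)
    finally have "U (xdag - x) + norm U * (norm U / (2 * c\<^sub>0)) powr (1 / (p - 1))
        \<le> - ((Q - 3 * \<kappa>) * N)"
      using lin by (simp add: algebra_simps)
    also have "\<dots> \<le> 0" using parameters N by (simp add: \<kappa>_def Q_def)
    finally show ?thesis .
  qed
  then show ?thesis using upd by (simp add: U_def)
qed

lemma iter_0: "iter \<delta> v 0 = (x\<^sub>0, \<xi>\<^sub>0)"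
  by (simp add: iterates_def)

lemma snd_iter_Suc: "snd (iter \<delta> v (Suc n)) = snd (iter \<delta> v n) - update \<delta> v (fst (iter \<delta> v n))"
  and fst_iter_Suc: "fst (iter \<delta> v (Suc n)) = grad_conjugate \<Theta> (snd (iter \<delta> v (Suc n)))"
  using iteration_step_eq[of F F' \<Theta> p r q \<mu>\<^sub>0 B\<^sub>0 \<tau> \<delta> v "fst (iter \<delta> v n)" "snd (iter \<delta> v n)"]
  by (simp_all add: iterates_def Let_def)

lemma snd_iter_subgradient: "snd (iter \<delta> v n) \<in> subdifferential \<Theta> (fst (iter \<delta> v n))"
  by (cases n) (simp_all add: iter_0 xi0 fst_iter_Suc subgradient_grad_conjugate[OF X_smooth])

text \<open>This includes \<open>n = 0\<close>, where \<open>x\<^sub>0\<close> is not computed from \<open>\<xi>\<^sub>0\<close> by the iteration, but is the gradient of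
  the conjugate there since \<open>\<xi>\<^sub>0\<close> is a subgradient at \<open>x\<^sub>0\<close>. So the dual sequence determines the primal one.\<close>

lemma fst_iter: "fst (iter \<delta> v n) = grad_conjugate \<Theta> (snd (iter \<delta> v n))"
  using grad_conjugate_eq[OF X_smooth snd_iter_subgradient] by simp



lemma
  assumes noise: "norm (y - v) \<le> \<delta>"
  shows bregman_iter_le: "\<theta> xdag - \<theta> (fst (iter \<delta> v n)) - snd (iter \<delta> v n) (xdag - fst (iter \<delta> v n))
      \<le> \<theta> xdag - \<theta> x\<^sub>0 - \<xi>\<^sub>0 (xdag - x\<^sub>0)" (is "?le n")
    and fst_iter_in_cball: "fst (iter \<delta> v n) \<in> cball x\<^sub>0 (2 * \<rho>)" (is "?in n")
proof -
  have cball: "?in n" if "?le n" for n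
  proof -
    have "dist xdag (fst (iter \<delta> v n)) \<le> \<rho>"
      by (rule dist_xdag_le_if_bregman_le[OF snd_iter_subgradient that])
    then show ?thesis
      using xdag_in_cball dist_triangle[of x\<^sub>0 "fst (iter \<delta> v n)" xdag] by simp
  qed
  show "?le n"
  proof (induction n)
    case 0
    then show ?case by (simp add: iter_0)
  next
    case (Suc n)
    have "snd (iter \<delta> v n) - update \<delta> v (fst (iter \<delta> v n)) \<in> subdifferential \<Theta> (fst (iter \<delta> v (Suc n)))"
      using snd_iter_subgradient[of \<delta> v "Suc n"] by (simp only: snd_iter_Suc)
    from bregman_step_le[OF snd_iter_subgradient cball[OF Suc] noise this] Suc
    show ?case by (simp only: snd_iter_Suc)
  qed
  then show "?in n" by (rule cball)
qed


section \<open>Stability with respect to the noise level\<close>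

text \<open>By the tangential cone condition the gradient \<open>F' x\<^sup>* res\<close> of the residual functional vanishes at no point
  of the ball except solutions. Hence both duality mappings are evaluated away from 0, where they are continuous.\<close>

lemma dual_op_residual_nonzero:
  assumes x: "x \<in> cball x\<^sub>0 (2 * \<rho>)" and "F x \<noteq> y"
  shows "dual_op (F' x) (duality_map r (F x - y)) \<noteq> 0"
proof
  let ?res = "duality_map r (F x - y)" and ?d = "norm (F x - y)"
  assume "dual_op (F' x) ?res = 0"
  then have zero: "?res (F' x (xdag - x)) = 0"
    by (metis blinfun.zero_left blinfun_apply_blinfun_compose dual_op_def)
  have d: "?d > 0" using \<open>F x \<noteq> y\<close> by simp
  have "xdag \<in> cball x\<^sub>0 (2 * \<rho>)" using xdag_in_cball rho_pos by auto
  from tcc[OF this x]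
  have E: "norm (y - F x - F' x (xdag - x)) \<le> \<eta> * ?d"
    by (simp add: xdag_sol(2) norm_minus_commute)
  have "?d powr r = - ?res (y - F x - F' x (xdag - x))"
    using zero duality_map_self[OF Y_smooth, of r "F x - y"] by (simp add: blinfun.diff_right)
  also have "\<dots> \<le> norm ?res * norm (y - F x - F' x (xdag - x))"
    using norm_blinfun[of ?res "y - F x - F' x (xdag - x)"] by simp
  also have "\<dots> \<le> ?d powr (r - 1) * (\<eta> * ?d)"
    unfolding norm_duality_map[OF Y_smooth] by (intro mult_left_mono E) simp
  also have "\<dots> = \<eta> * ?d powr r" using d by (simp add: powr_diff)
  finally show False using d eta(2) by simp
qed

text \<open>Otherwise the pairing of \<open>F' x\<^sup>* res\<close> with the dual step, a power of its nonzero norm, would vanish.\<close>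

lemma dual_step_nonzero:
  assumes x: "x \<in> cball x\<^sub>0 (2 * \<rho>)" and "F x \<noteq> y"
  shows "F' x (dual_duality_map q (dual_op (F' x) (duality_map r (F x - y)))) \<noteq> 0"
proof
  let ?\<xi> = "dual_op (F' x) (duality_map r (F x - y))"
  assume "F' x (dual_duality_map q ?\<xi>) = 0"
  then have "?\<xi> (dual_duality_map q ?\<xi>) = 0" by (simp add: dual_op_def blinfun.zero_right)
  then show False
    using dual_op_residual_nonzero[OF assms] by (simp add: dual_duality_map_pairing[OF X_convex])
qed

text \<open>At a solution the step size and the directions of the noisy iteration need not converge, but the length
  of the step is bounded by a power of the residual, which tends to 0. Away from solutions the
  discrepancy test is eventually passed and every ingredient of the step is continuous.\<close>

lemma tendsto_update:
  fixes X :: "real \<Rightarrow> 'a" and v :: "real \<Rightarrow> 'b"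
  assumes X: "(X \<longlongrightarrow> x) (at_right 0)" "\<forall>\<^sub>F \<delta> in at_right 0. X \<delta> \<in> cball x\<^sub>0 (2 * \<rho>)"
    and x: "x \<in> cball x\<^sub>0 (2 * \<rho>)" and v: "(v \<longlongrightarrow> y) (at_right 0)"
  shows "((\<lambda>\<delta>. update \<delta> (v \<delta>) (X \<delta>)) \<longlongrightarrow> update 0 y x) (at_right 0)"
proof -
  have FX: "((\<lambda>\<delta>. F (X \<delta>)) \<longlongrightarrow> F x) (at_right 0)"
    by (rule continuous_on_tendsto_compose[OF F_cont X(1) x X(2)])
  have F'X: "((\<lambda>\<delta>. F' (X \<delta>)) \<longlongrightarrow> F' x) (at_right 0)"
    by (rule continuous_on_tendsto_compose[OF F'_cont X(1) x X(2)])
  have R: "((\<lambda>\<delta>. F (X \<delta>) - v \<delta>) \<longlongrightarrow> F x - y) (at_right 0)"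
    by (intro tendsto_intros FX v)
  show ?thesis
  proof (cases "F x = y")
    case True
    have "((\<lambda>\<delta>. 3 * \<mu>\<^sub>0 * (norm (F (X \<delta>) - v \<delta>) / B\<^sub>0) powr (p - 1)) \<longlongrightarrow>
        3 * \<mu>\<^sub>0 * (norm (F x - y) / B\<^sub>0) powr (p - 1)) (at_right 0)"
      using B0_pos p_gt by (intro tendsto_intros R) (auto intro!: always_eventually)
    then have "((\<lambda>\<delta>. 3 * \<mu>\<^sub>0 * (norm (F (X \<delta>) - v \<delta>) / B\<^sub>0) powr (p - 1)) \<longlongrightarrow> 0) (at_right 0)"
      using True by simp
    then have "((\<lambda>\<delta>. update \<delta> (v \<delta>) (X \<delta>)) \<longlongrightarrow> 0) (at_right 0)"
      by (rule Lim_null_comparison[rotated])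
        (use X(2) in \<open>elim eventually_mono, intro norm_update_le\<close>)
    moreover have "update 0 y x = 0" using True by (simp add: step_size_def)
    ultimately show ?thesis by (simp only:)
  next
    case False
    let ?res = "\<lambda>\<delta>. duality_map r (F (X \<delta>) - v \<delta>)" and ?lim = "duality_map r (F x - y)"
    have res: "(?res \<longlongrightarrow> ?lim) (at_right 0)"
      by (rule tendsto_duality_map[OF Y_smooth R]) (use False in simp)
    have w: "((\<lambda>\<delta>. duality_map r (F' (X \<delta>) (dual_duality_map q (dual_op (F' (X \<delta>)) (?res \<delta>))))) \<longlongrightarrow>
        duality_map r (F' x (dual_duality_map q (dual_op (F' x) ?lim)))) (at_right 0)" (is "(?w \<longlongrightarrow> ?wlim) _")
      by (intro tendsto_duality_map[OF Y_smooth] blinfun.tendsto tendsto_dual_duality_map[OF X_convex] tendsto_dual_op F'X res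
          dual_op_residual_nonzero dual_step_nonzero x False)
    have "norm ?wlim \<noteq> 0"
      using dual_step_nonzero[OF x False] by (simp add: norm_duality_map[OF Y_smooth])
    then have dir: "((\<lambda>\<delta>. search_direction F F' r q (v \<delta>) (X \<delta>)) \<longlongrightarrow> search_direction F F' r q y x) (at_right 0)"
      unfolding search_direction_def Let_def by (intro tendsto_intros res w)
    have "((\<lambda>\<delta>. \<mu>\<^sub>0 * B\<^sub>0 powr (- p) * norm (F (X \<delta>) - v \<delta>) powr (p - r)) \<longlongrightarrow>
        \<mu>\<^sub>0 * B\<^sub>0 powr (- p) * norm (F x - y) powr (p - r)) (at_right 0)"
      by (intro tendsto_intros R) (use False in simp)
    moreover have "\<forall>\<^sub>F \<delta> in at_right 0. \<mu>\<^sub>0 * B\<^sub>0 powr (- p) * norm (F (X \<delta>) - v \<delta>) powr (p - r)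
        = step_size p r \<mu>\<^sub>0 B\<^sub>0 \<tau> \<delta> (norm (F (X \<delta>) - v \<delta>))"
    proof -
      have "((\<lambda>\<delta>. norm (F (X \<delta>) - v \<delta>) - \<tau> * \<delta>) \<longlongrightarrow> norm (F x - y) - \<tau> * 0) (at_right 0)"
        by (intro tendsto_intros R)
      then have "\<forall>\<^sub>F \<delta> in at_right 0. 0 < norm (F (X \<delta>) - v \<delta>) - \<tau> * \<delta>"
        by (rule order_tendstoD) (use False in simp)
      then show ?thesis by eventually_elim (simp add: step_size_def)
    qed
    ultimately have "((\<lambda>\<delta>. step_size p r \<mu>\<^sub>0 B\<^sub>0 \<tau> \<delta> (norm (F (X \<delta>) - v \<delta>))) \<longlongrightarrow>
        \<mu>\<^sub>0 * B\<^sub>0 powr (- p) * norm (F x - y) powr (p - r)) (at_right 0)"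
      by (rule Lim_transform_eventually)
    moreover have "step_size p r \<mu>\<^sub>0 B\<^sub>0 \<tau> 0 (norm (F x - y)) =
        \<mu>\<^sub>0 * B\<^sub>0 powr (- p) * norm (F x - y) powr (p - r)"
      using False by (simp add: step_size_def)
    ultimately have size: "((\<lambda>\<delta>. step_size p r \<mu>\<^sub>0 B\<^sub>0 \<tau> \<delta> (norm (F (X \<delta>) - v \<delta>))) \<longlongrightarrow>
        step_size p r \<mu>\<^sub>0 B\<^sub>0 \<tau> 0 (norm (F x - y))) (at_right 0)" by simp
    show ?thesis by (intro tendsto_scaleR tendsto_dual_op size dir F'X)
  qed
qed

lemma iter_stable:
  assumes noise: "\<And>\<delta>. \<delta> > 0 \<Longrightarrow> norm (y - v \<delta>) \<le> \<delta>"
  shows "((\<lambda>\<delta>. snd (iter \<delta> (v \<delta>) n)) \<longlongrightarrow> snd (iter 0 y n)) (at_right 0)"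
    and "((\<lambda>\<delta>. fst (iter \<delta> (v \<delta>) n)) \<longlongrightarrow> fst (iter 0 y n)) (at_right 0)"
proof -
  have pos: "\<forall>\<^sub>F \<delta> in at_right (0::real). \<delta> > 0" by (simp add: eventually_at_right_less)
  have v: "(v \<longlongrightarrow> y) (at_right 0)"
  proof (rule LIM_zero_cancel, rule Lim_null_comparison)
    show "\<forall>\<^sub>F \<delta> in at_right 0. norm (v \<delta> - y) \<le> \<delta>"
      using pos by eventually_elim (simp add: noise norm_minus_commute)
  qed (rule tendsto_ident_at)
  have fst_if_snd: "((\<lambda>\<delta>. fst (iter \<delta> (v \<delta>) n)) \<longlongrightarrow> fst (iter 0 y n)) (at_right 0)"
    if "((\<lambda>\<delta>. snd (iter \<delta> (v \<delta>) n)) \<longlongrightarrow> snd (iter 0 y n)) (at_right 0)" for n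
    unfolding fst_iter by (rule tendsto_grad_conjugate[OF X_smooth that])
  show snd: "((\<lambda>\<delta>. snd (iter \<delta> (v \<delta>) n)) \<longlongrightarrow> snd (iter 0 y n)) (at_right 0)"
  proof (induction n)
    case 0
    then show ?case by (simp add: iter_0)
  next
    case (Suc n)
    have "\<forall>\<^sub>F \<delta> in at_right 0. fst (iter \<delta> (v \<delta>) n) \<in> cball x\<^sub>0 (2 * \<rho>)"
      using pos by eventually_elim (rule fst_iter_in_cball[OF noise])
    moreover have "fst (iter 0 y n) \<in> cball x\<^sub>0 (2 * \<rho>)" by (rule fst_iter_in_cball) simp
    ultimately show ?case
      unfolding snd_iter_Suc by (intro tendsto_diff Suc tendsto_update fst_if_snd v)
  qed
  show "((\<lambda>\<delta>. fst (iter \<delta> (v \<delta>) n)) \<longlongrightarrow> fst (iter 0 y n)) (at_right 0)"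
    by (rule fst_if_snd[OF snd])
qed

end

theorem theorem3p5:
  fixes F :: "'a::banach \<Rightarrow> 'b::banach"
    and F' :: "'a \<Rightarrow> 'a \<Rightarrow>\<^sub>L 'b"
    and DF :: "'a set"
    and \<Theta> :: "'a \<Rightarrow> ereal"
    and p r s s' \<rho> B\<^sub>0 \<eta> c\<^sub>0 \<tau> \<mu>\<^sub>0 :: real
    and x\<^sub>0 xdag :: 'a
    and \<xi>\<^sub>0 :: "'a \<Rightarrow>\<^sub>L real"
    and y :: 'b
    and ydelta :: "real \<Rightarrow> 'b"
  assumes X_smooth: "uniformly_smooth TYPE('a)"
    and X_convex: "uniformly_convex TYPE('a)"
    and s_ge: "s \<ge> 2"
    and X_s_convex: "power_convex_space TYPE('a) s"
    and s_conj: "1 / s + 1 / s' = 1"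
    and Y_smooth: "uniformly_smooth TYPE('b)"
    and r_gt: "1 < r"
    and p_ge: "p \<ge> 2"
    and Theta_proper: "proper_fun \<Theta>"
    and Theta_lsc: "lsc_fun \<Theta>"
    and Theta_p_convex: "p_convex_fun p \<Theta>"
    and c0_pos: "c\<^sub>0 > 0"
    and Theta_bregman: "\<And>z x \<xi>. x \<in> subdiff_domain \<Theta> \<Longrightarrow> \<xi> \<in> subdifferential \<Theta> x \<Longrightarrow>
          bregman \<Theta> \<xi> z x \<ge> ereal (c\<^sub>0 * norm (z - x) powr p)"
    and x0: "x\<^sub>0 \<in> subdiff_domain \<Theta>"
    and xi0: "\<xi>\<^sub>0 \<in> subdifferential \<Theta> x\<^sub>0"
    and rho_pos: "\<rho> > 0"
    and ball_DF: "cball x\<^sub>0 (2 * \<rho>) \<subseteq> DF"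
    and ex_solution: "\<exists>x \<in> cball x\<^sub>0 \<rho> \<inter> effective_domain \<Theta>. F x = y"
    and F_weakly_closed: "weakly_closed_on F DF"
    and F_deriv: "\<And>x. x \<in> cball x\<^sub>0 (2 * \<rho>) \<Longrightarrow>
          (F has_derivative blinfun_apply (F' x)) (at x within cball x\<^sub>0 (2 * \<rho>))"
    and F'_cont: "continuous_on (cball x\<^sub>0 (2 * \<rho>)) F'"
    and B0_pos: "B\<^sub>0 > 0"
    and F'_bound: "\<And>x. x \<in> cball x\<^sub>0 (2 * \<rho>) \<Longrightarrow> norm (F' x) \<le> B\<^sub>0"
    and eta: "0 \<le> \<eta>" "\<eta> < 1"
    and tcc: "\<And>x z. x \<in> cball x\<^sub>0 (2 * \<rho>) \<Longrightarrow> z \<in> cball x\<^sub>0 (2 * \<rho>) \<Longrightarrow>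
          norm (F x - F z - blinfun_apply (F' z) (x - z)) \<le> \<eta> * norm (F x - F z)"
    and xdag_sol: "xdag \<in> effective_domain \<Theta> \<inter> DF" "F xdag = y"
    and xdag_min: "\<And>x. x \<in> effective_domain \<Theta> \<inter> DF \<Longrightarrow> F x = y \<Longrightarrow>
          bregman \<Theta> \<xi>\<^sub>0 xdag x\<^sub>0 \<le> bregman \<Theta> \<xi>\<^sub>0 x x\<^sub>0"
    and xdag_close: "bregman \<Theta> \<xi>\<^sub>0 xdag x\<^sub>0 \<le> ereal (c\<^sub>0 * \<rho> powr p)"
    and tau_gt: "\<tau> > 1"
    and mu0_pos: "\<mu>\<^sub>0 > 0"
    and parameters: "1 - 3 * \<eta> - 3 * (\<eta> + 1) / \<tau>
          - 3 * (3 * \<mu>\<^sub>0 / (2 * c\<^sub>0)) powr (1 / (p - 1)) > 0"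
    and noise: "\<And>\<delta>. \<delta> > 0 \<Longrightarrow> norm (y - ydelta \<delta>) \<le> \<delta>"
  shows "\<forall>n.
      ((\<lambda>\<delta>. snd (iterates F F' \<Theta> p r s' \<mu>\<^sub>0 B\<^sub>0 \<tau> x\<^sub>0 \<xi>\<^sub>0 \<delta> (ydelta \<delta>) n))
         \<longlongrightarrow> snd (iterates F F' \<Theta> p r s' \<mu>\<^sub>0 B\<^sub>0 \<tau> x\<^sub>0 \<xi>\<^sub>0 0 y n)) (at_right 0) \<and>
      ((\<lambda>\<delta>. fst (iterates F F' \<Theta> p r s' \<mu>\<^sub>0 B\<^sub>0 \<tau> x\<^sub>0 \<xi>\<^sub>0 \<delta> (ydelta \<delta>) n))
         \<longlongrightarrow> fst (iterates F F' \<Theta> p r s' \<mu>\<^sub>0 B\<^sub>0 \<tau> x\<^sub>0 \<xi>\<^sub>0 0 y n)) (at_right 0)"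
proof -
  have F_cont: "continuous_on (cball x\<^sub>0 (2 * \<rho>)) F"
    unfolding continuous_on_eq_continuous_within
    using F_deriv has_derivative_continuous by blast
  interpret landweber_iteration \<Theta> p c\<^sub>0 F F' r s' \<rho> B\<^sub>0 \<eta> \<tau> \<mu>\<^sub>0 x\<^sub>0 xdag \<xi>\<^sub>0 y
    by unfold_locales
      (use assms F_cont in \<open>auto simp: less_imp_le\<close>)
  show ?thesis using iter_stable[OF noise] by blast
qed

end
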